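(* Let $E$ be a separable real Hilbert space and let $p\geq4$ be an even integer. If $\Phi\colon\mathcal{W}_p(E)\to\mathcal{W}_p(E)$ is an isometry (distance preserving bijection), then there exists an (affine) isometry $\psi\colon E\to E$ such that $\Phi(\mu)=\psi_\#\mu$ for all $\mu\in\mathcal{W}_p(E)$.
   Context: $\mathcal{W}_p(E)$ is the set of Borel probability measures $\mu$ on $E$ with $\int_E\|x\|^p\,d\mu(x)<\infty$, equipped with $d_{\mathcal{W}_p}(\mu,\nu)=\big(\inf_{\pi\in\Pi(\mu,\nu)}\int_{E\times E}\|x-y\|^p\,d\pi(x,y)\big)^{1/p}$, where $\Pi(\mu,\nu)$ is the set of Borel probability measures on $E\times E$ with marginals $\mu$ and $\nu$. The push-forward is $(g_\#\mu)(A)=\mu(g^{-1}[A])$. *)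

theory Defs
  imports "HOL-Probability.Probability"
begin

definition Wasserstein_space :: "nat \<Rightarrow> ('a::{real_normed_vector, second_countable_topology}) measure set" where
  "Wasserstein_space p = {\<mu>. sets \<mu> = sets borel \<and> prob_space \<mu> \<and>
      (\<integral>\<^sup>+ x. ennreal (norm x ^ p) \<partial>\<mu>) < \<infinity>}"

definition couplings :: "('a::{real_normed_vector, second_countable_topology}) measure \<Rightarrow> 'a measure \<Rightarrow> ('a \<times> 'a) measure set" where
  "couplings \<mu> \<nu> = {\<pi>. sets \<pi> = sets borel \<and> prob_space \<pi> \<and>
      distr \<pi> borel fst = \<mu> \<and> distr \<pi> borel snd = \<nu>}"

definition wasserstein_dist :: "nat \<Rightarrow> ('a::{real_normed_vector, second_countable_topology}) measure \<Rightarrow> 'a measure \<Rightarrow> real" where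
  "wasserstein_dist p \<mu> \<nu> =
     enn2real (INF \<pi>\<in>couplings \<mu> \<nu>. \<integral>\<^sup>+ z. ennreal (norm (fst z - snd z) ^ p) \<partial>\<pi>) powr (1 / real p)"

end

theory Submission
  imports Defs "HOL-Computational_Algebra.Polynomial"
begin

text \<open>
  Dirac measures are exactly the \<open>\<mu>\<close> such that every \<open>a\<close> is the midpoint of \<open>\<mu>\<close> and some \<open>b\<close>:
  from a Dirac measure one dilates, and conversely, if a Dirac measure is the midpoint of \<open>\<mu>\<close> and \<open>b\<close>,
  strict convexity applied to the product coupling makes \<open>\<mu>\<close> a Dirac measure. Hence \<open>\<Phi>\<close> permutes the
  Dirac measures through an isometry \<open>\<psi>\<close> of the Hilbert space, and after composing with the inverse of
  \<open>\<psi>\<close> it fixes them. It then preserves the potentials \<open>x \<mapsto> \<integral> \<parallel>x - y\<parallel>\<^sup>p d\<mu>(y)\<close>; for even \<open>p\<close> these are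
  polynomials along lines, and as \<open>p \<ge> 4\<close> their coefficients contain enough moments of \<open>\<mu>\<close> to identify
  measures on two points. Distances to measures on \<open>{a, b}\<close> determine
  \<open>\<integral> min (\<parallel>y - a\<parallel>\<^sup>p) (\<parallel>y - b\<parallel>\<^sup>p - t) d\<mu>(y)\<close>, and differentiating in \<open>t\<close> gives the measures of all
  half-spaces, hence all one-dimensional marginals. These identify finitely supported measures,
  which are dense.
\<close>

section \<open>Transport cost\<close>

text \<open>For \<open>p > 0\<close> and measures in the space, this is the \<open>p\<close>-th
  power of \<open>wasserstein_dist\<close>. It stays in \<open>ennreal\<close>, so that infima and
  integrals can be compared before anything is known to be finite.\<close>

definition transport_cost ::
  "nat \<Rightarrow> ('a::{real_normed_vector, second_countable_topology}) measure \<Rightarrow> 'a measure \<Rightarrow> ennreal" where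
  "transport_cost p \<mu> \<nu> =
     (INF \<pi>\<in>couplings \<mu> \<nu>. \<integral>\<^sup>+ z. ennreal (norm (fst z - snd z) ^ p) \<partial>\<pi>)"

lemma wasserstein_spaceD:
  assumes "\<mu> \<in> Wasserstein_space p"
  shows "sets \<mu> = sets borel" "prob_space \<mu>" "(\<integral>\<^sup>+ x. ennreal (norm x ^ p) \<partial>\<mu>) < \<infinity>" "space \<mu> = UNIV"
  using assms sets_eq_imp_space_eq[of \<mu> borel] by (auto simp: Wasserstein_space_def)

lemma measurable_wasserstein_space:
  assumes "\<mu> \<in> Wasserstein_space p"
  shows "measurable \<mu> N = measurable borel N"
  using measurable_cong_sets[OF wasserstein_spaceD(1)[OF assms] refl] .

section \<open>Couplings and their marginals\<close>

lemma couplingsD: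
  assumes "\<pi> \<in> couplings \<mu> \<nu>"
  shows "sets \<pi> = sets borel" "prob_space \<pi>" "distr \<pi> borel fst = \<mu>" "distr \<pi> borel snd = \<nu>"
    "measurable \<pi> N = measurable borel N" "space \<pi> = UNIV"
  using assms sets_eq_imp_space_eq[of \<pi> borel] measurable_cong_sets[of \<pi> borel N N]
  by (auto simp: couplings_def)

lemma couplings_measurable:
  assumes "\<pi> \<in> couplings \<mu> (\<nu> :: 'a::{real_normed_vector, second_countable_topology} measure)"
  shows "fst \<in> measurable \<pi> (borel :: 'a measure)" "snd \<in> measurable \<pi> (borel :: 'a measure)"
  unfolding couplingsD(5)[OF assms] by (auto intro!: borel_measurable_continuous_onI continuous_intros)

lemma nn_integral_coupling:
  fixes f :: "'a::{real_normed_vector, second_countable_topology} \<Rightarrow> ennreal"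
  assumes "\<pi> \<in> couplings \<mu> \<nu>" "f \<in> borel_measurable borel"
  shows "(\<integral>\<^sup>+ z. f (fst z) \<partial>\<pi>) = (\<integral>\<^sup>+ x. f x \<partial>\<mu>)" "(\<integral>\<^sup>+ z. f (snd z) \<partial>\<pi>) = (\<integral>\<^sup>+ x. f x \<partial>\<nu>)"
proof -
  note [measurable] = couplings_measurable[OF assms(1)]
  note assms(2)[measurable]
  show "(\<integral>\<^sup>+ z. f (fst z) \<partial>\<pi>) = (\<integral>\<^sup>+ x. f x \<partial>\<mu>)"
    by (subst couplingsD(3)[OF assms(1), symmetric], subst nn_integral_distr) auto
  show "(\<integral>\<^sup>+ z. f (snd z) \<partial>\<pi>) = (\<integral>\<^sup>+ x. f x \<partial>\<nu>)"
    by (subst couplingsD(4)[OF assms(1), symmetric], subst nn_integral_distr) auto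
qed

lemma integrable_coupling:
  fixes f :: "'a::{real_normed_vector, second_countable_topology} \<Rightarrow> real"
  assumes "\<pi> \<in> couplings \<mu> \<nu>" "f \<in> borel_measurable borel"
  shows "integrable \<mu> f \<Longrightarrow> integrable \<pi> (\<lambda>z. f (fst z))"
    "integrable \<nu> f \<Longrightarrow> integrable \<pi> (\<lambda>z. f (snd z))"
    "(\<integral>z. f (fst z) \<partial>\<pi>) = (\<integral>x. f x \<partial>\<mu>)" "(\<integral>z. f (snd z) \<partial>\<pi>) = (\<integral>x. f x \<partial>\<nu>)"
proof -
  note [measurable] = couplings_measurable[OF assms(1)]
  note assms(2)[measurable]
  show "integrable \<mu> f \<Longrightarrow> integrable \<pi> (\<lambda>z. f (fst z))"
    using integrable_distr_eq[of fst \<pi> borel f] couplingsD(3)[OF assms(1)] by simp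
  show "integrable \<nu> f \<Longrightarrow> integrable \<pi> (\<lambda>z. f (snd z))"
    using integrable_distr_eq[of snd \<pi> borel f] couplingsD(4)[OF assms(1)] by simp
  show "(\<integral>z. f (fst z) \<partial>\<pi>) = (\<integral>x. f x \<partial>\<mu>)"
    using integral_distr[of fst \<pi> borel f] couplingsD(3)[OF assms(1)] by simp
  show "(\<integral>z. f (snd z) \<partial>\<pi>) = (\<integral>x. f x \<partial>\<nu>)"
    using integral_distr[of snd \<pi> borel f] couplingsD(4)[OF assms(1)] by simp
qed

lemma AE_coupling:
  fixes P :: "'a::{real_normed_vector, second_countable_topology} \<Rightarrow> bool"
  assumes "\<pi> \<in> couplings \<mu> \<nu>"
  shows "(AE x in \<mu>. P x) \<Longrightarrow> AE z in \<pi>. P (fst z)" "(AE x in \<nu>. P x) \<Longrightarrow> AE z in \<pi>. P (snd z)"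
proof -
  note [measurable] = couplings_measurable[OF assms(1)]
  show "(AE x in \<mu>. P x) \<Longrightarrow> AE z in \<pi>. P (fst z)"
    using AE_distrD[of fst \<pi> borel P] unfolding couplingsD(3)[OF assms(1)] by simp
  show "(AE x in \<nu>. P x) \<Longrightarrow> AE z in \<pi>. P (snd z)"
    using AE_distrD[of snd \<pi> borel P] unfolding couplingsD(4)[OF assms(1)] by simp
qed

lemma transport_cost_le:
  "\<pi> \<in> couplings \<mu> \<nu> \<Longrightarrow> transport_cost p \<mu> \<nu> \<le> (\<integral>\<^sup>+ z. ennreal (norm (fst z - snd z) ^ p) \<partial>\<pi>)"
  unfolding transport_cost_def by (rule INF_lower)

lemma norm_diff_measurable [measurable]:
  "(\<lambda>z. ennreal (norm (fst z - snd z) ^ p))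
     \<in> borel_measurable (borel :: ('a::{real_normed_vector, second_countable_topology} \<times> 'a) measure)"
  by (intro measurable_compose[OF _ measurable_ennreal] borel_measurable_continuous_onI continuous_intros)

lemma nn_integral_norm_diff_distr:
  fixes T :: "'b \<Rightarrow> 'a \<times> 'a::{real_normed_vector, second_countable_topology}"
  assumes "T \<in> borel_measurable M"
  shows "(\<integral>\<^sup>+ z. ennreal (norm (fst z - snd z) ^ p) \<partial>distr M borel T)
    = (\<integral>\<^sup>+ x. ennreal (norm (fst (T x) - snd (T x)) ^ p) \<partial>M)"
  by (rule nn_integral_distr) (simp_all only: measurable_distr_eq1 norm_diff_measurable assms)

text \<open>The joint law of two random variables couples their laws. Apart from the product, every
  coupling constructed here is of this kind.\<close>

lemma distr_pair_in_couplings: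
  fixes f g :: "'b \<Rightarrow> 'a::{real_normed_vector, second_countable_topology}"
  assumes "prob_space M" and [measurable]: "f \<in> borel_measurable M" "g \<in> borel_measurable M"
  shows "distr M borel (\<lambda>x. (f x, g x)) \<in> couplings (distr M borel f) (distr M borel g)"
proof -
  have [measurable]: "fst \<in> measurable borel (borel :: 'a measure)" "snd \<in> measurable borel (borel :: 'a measure)"
    by (auto intro!: borel_measurable_continuous_onI continuous_intros)
  show ?thesis
    unfolding couplings_def using prob_space.prob_space_distr[OF assms(1), of "\<lambda>x. (f x, g x)" borel]
    by (auto simp: distr_distr comp_def)
qed

lemma transport_cost_distr_le:
  fixes f g :: "'b \<Rightarrow> 'a::{real_normed_vector, second_countable_topology}"
  assumes "prob_space M" and [measurable]: "f \<in> borel_measurable M" "g \<in> borel_measurable M"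
  shows "transport_cost p (distr M borel f) (distr M borel g) \<le> (\<integral>\<^sup>+ x. ennreal (norm (f x - g x) ^ p) \<partial>M)"
proof -
  have "(\<lambda>x. (f x, g x)) \<in> borel_measurable M" by simp
  then show ?thesis
    using transport_cost_le[OF distr_pair_in_couplings[OF assms], of p]
    by (simp add: nn_integral_norm_diff_distr)
qed

lemma transport_cost_map_le:
  fixes T :: "'a \<Rightarrow> 'a::{real_normed_vector, second_countable_topology}"
  assumes "\<mu> \<in> Wasserstein_space q" "T \<in> borel_measurable borel"
  shows "transport_cost p \<mu> (distr \<mu> borel T) \<le> (\<integral>\<^sup>+ x. ennreal (norm (x - T x) ^ p) \<partial>\<mu>)"
proof -
  have *: "distr \<mu> borel (\<lambda>x. x) = \<mu>"
    by (rule distr_id2) (simp add: wasserstein_spaceD[OF assms(1)])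
  show ?thesis
    using transport_cost_distr_le[of \<mu> "\<lambda>x. x" T p] assms wasserstein_spaceD[OF assms(1)]
    by (simp add: * measurable_wasserstein_space[OF assms(1)])
qed

lemma couplings_swap:
  assumes "\<pi> \<in> couplings \<mu> (\<nu> :: 'a::{real_normed_vector, second_countable_topology} measure)"
  shows "distr \<pi> borel (\<lambda>z. (snd z, fst z)) \<in> couplings \<nu> \<mu>"
proof -
  note [measurable] = couplings_measurable[OF assms(1)]
  show ?thesis
    using distr_pair_in_couplings[OF couplingsD(2)[OF assms], of snd fst] couplingsD[OF assms] by simp
qed

lemma transport_cost_commute:
  fixes \<mu> \<nu> :: "'a::{real_normed_vector, second_countable_topology} measure"
  shows "transport_cost p \<mu> \<nu> = transport_cost p \<nu> \<mu>"
proof -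
  have le: "transport_cost p \<nu> \<mu> \<le> transport_cost p \<mu> \<nu>" for \<mu> \<nu> :: "'a measure"
    unfolding transport_cost_def[of p \<mu> \<nu>]
  proof (rule INF_greatest)
    fix \<pi> assume \<pi>: "\<pi> \<in> couplings \<mu> \<nu>"
    have m: "(\<lambda>z. (snd z, fst z)) \<in> measurable \<pi> borel"
      unfolding couplingsD(5)[OF \<pi>] by (intro borel_measurable_continuous_onI continuous_intros)
    show "transport_cost p \<nu> \<mu> \<le> (\<integral>\<^sup>+ z. ennreal (norm (fst z - snd z) ^ p) \<partial>\<pi>)"
      using transport_cost_le[OF couplings_swap[OF \<pi>], of p]
      by (simp add: nn_integral_norm_diff_distr[OF m] norm_minus_commute)
  qed
  show ?thesis by (intro antisym le)
qed

text \<open>The product coupling shows that costs are finite and that infima over couplings are not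
  over the empty set; it is also the test coupling in the characterisation of Dirac
  measures.\<close>

lemma pair_measure_in_couplings:
  fixes \<mu> \<nu> :: "'a::{real_normed_vector, second_countable_topology} measure"
  assumes "\<mu> \<in> Wasserstein_space p" "\<nu> \<in> Wasserstein_space p"
  shows "\<mu> \<Otimes>\<^sub>M \<nu> \<in> couplings \<mu> \<nu>"
proof -
  note [simp] = wasserstein_spaceD(1)[OF assms(1)] wasserstein_spaceD(1)[OF assms(2)]
  interpret M: prob_space \<mu> by (rule wasserstein_spaceD[OF assms(1)])
  interpret N: prob_space \<nu> by (rule wasserstein_spaceD[OF assms(2)])
  interpret P: pair_prob_space \<mu> \<nu> ..
  have sets: "sets (\<mu> \<Otimes>\<^sub>M \<nu>) = sets borel"
    by (simp add: borel_prod[symmetric] cong: sets_pair_measure_cong)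
  have 1: "distr (\<mu> \<Otimes>\<^sub>M \<nu>) borel fst = \<mu>"
    using N.distr_pair_fst[of \<mu>] distr_cong[of "\<mu> \<Otimes>\<^sub>M \<nu>" "\<mu> \<Otimes>\<^sub>M \<nu>" borel \<mu> fst fst] by simp
  have "distr (\<mu> \<Otimes>\<^sub>M \<nu>) \<nu> snd = distr (distr (\<nu> \<Otimes>\<^sub>M \<mu>) (\<mu> \<Otimes>\<^sub>M \<nu>) (\<lambda>(x, y). (y, x))) \<nu> snd"
    by (subst P.distr_pair_swap) simp
  also have "\<dots> = distr (\<nu> \<Otimes>\<^sub>M \<mu>) \<nu> fst"
    by (subst distr_distr) (auto simp: comp_def case_prod_unfold)
  also have "\<dots> = \<nu>" by (rule M.distr_pair_fst)
  finally have 2: "distr (\<mu> \<Otimes>\<^sub>M \<nu>) borel snd = \<nu>"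
    using distr_cong[of "\<mu> \<Otimes>\<^sub>M \<nu>" "\<mu> \<Otimes>\<^sub>M \<nu>" borel \<nu> snd snd] by simp
  show ?thesis
    using sets 1 2 P.prob_space_axioms by (simp add: couplings_def)
qed

section \<open>Moments and finiteness of the cost\<close>

lemma norm_diff_power_le:
  fixes x y :: "'a::real_normed_vector"
  shows "norm (x - y) ^ p \<le> 2 ^ p * (norm x ^ p + norm y ^ p)"
proof -
  have "norm (x - y) ^ p \<le> (2 * max (norm x) (norm y)) ^ p"
    using norm_triangle_ineq4[of x y] by (intro power_mono) auto
  also have "\<dots> = 2 ^ p * max (norm x) (norm y) ^ p" by (simp add: power_mult_distrib)
  also have "max (norm x) (norm y) ^ p \<le> norm x ^ p + norm y ^ p" by (auto simp: max_def)
  finally show ?thesis by simp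
qed

lemma wasserstein_space_integrable:
  fixes x :: "'a::{real_normed_vector, second_countable_topology}"
  assumes "\<mu> \<in> Wasserstein_space p"
  shows "integrable \<mu> (\<lambda>y. norm (y - x) ^ p)"
proof -
  note [simp] = measurable_wasserstein_space[OF assms]
  interpret prob_space \<mu> by (rule wasserstein_spaceD[OF assms])
  have "integrable \<mu> (\<lambda>y. norm y ^ p)"
    using wasserstein_spaceD(3)[OF assms] by (intro integrableI_nonneg) auto
  then have "integrable \<mu> (\<lambda>y. 2 ^ p * (norm y ^ p + norm x ^ p))" by auto
  then show ?thesis
    by (rule Bochner_Integration.integrable_bound) (auto simp: norm_diff_power_le)
qed

lemma wasserstein_space_nn_integral:
  fixes x :: "'a::{real_normed_vector, second_countable_topology}"
  assumes "\<mu> \<in> Wasserstein_space p"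
  shows "(\<integral>\<^sup>+ y. ennreal (norm (y - x) ^ p) \<partial>\<mu>) = ennreal (\<integral>y. norm (y - x) ^ p \<partial>\<mu>)"
  by (rule nn_integral_eq_integral[OF wasserstein_space_integrable[OF assms]]) auto

lemma transport_cost_finite:
  fixes \<mu> \<nu> :: "'a::{real_normed_vector, second_countable_topology} measure"
  assumes "\<mu> \<in> Wasserstein_space p" "\<nu> \<in> Wasserstein_space p"
  shows "transport_cost p \<mu> \<nu> < \<infinity>"
proof -
  let ?\<pi> = "\<mu> \<Otimes>\<^sub>M \<nu>"
  note c = pair_measure_in_couplings[OF assms]
  note m = couplingsD(5)[OF c]
  have [measurable]: "fst \<in> measurable ?\<pi> (borel :: 'a measure)" "snd \<in> measurable ?\<pi> (borel :: 'a measure)"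
    unfolding m by (auto intro!: borel_measurable_continuous_onI continuous_intros)
  have "(\<integral>\<^sup>+ z. ennreal (norm (fst z - snd z) ^ p) \<partial>?\<pi>)
      \<le> (\<integral>\<^sup>+ z. ennreal (2 ^ p) * (ennreal (norm (fst z) ^ p) + ennreal (norm (snd z) ^ p)) \<partial>?\<pi>)"
    by (intro nn_integral_mono)
      (auto simp: ennreal_mult[symmetric] ennreal_plus[symmetric] norm_diff_power_le simp del: ennreal_plus intro!: ennreal_leI)
  also have "\<dots> = ennreal (2 ^ p) * ((\<integral>\<^sup>+ x. ennreal (norm x ^ p) \<partial>\<mu>) + (\<integral>\<^sup>+ x. ennreal (norm x ^ p) \<partial>\<nu>))"
    by (subst nn_integral_cmult, simp, subst nn_integral_add, simp, simp)
      (simp add: nn_integral_coupling[OF c, where f="\<lambda>x. ennreal (norm x ^ p)"])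
  also have "\<dots> < \<infinity>"
    using wasserstein_spaceD(3)[OF assms(1)] wasserstein_spaceD(3)[OF assms(2)]
    by (simp add: ennreal_mult_less_top)
  finally show ?thesis using transport_cost_le[OF c, of p] by (rule le_less_trans[rotated])
qed

text \<open>Finiteness makes \<open>enn2real\<close> lossless, and raising to the power
  \<open>p\<close> undoes the root. After this, isometries are handled through
  \<open>transport_cost\<close> alone.\<close>

lemma transport_cost_eq_if_wasserstein_dist_eq:
  assumes "\<mu> \<in> Wasserstein_space p" "\<nu> \<in> Wasserstein_space p" "\<mu>' \<in> Wasserstein_space p" "\<nu>' \<in> Wasserstein_space p"
    and "p > 0" and eq: "wasserstein_dist p \<mu> \<nu> = wasserstein_dist p \<mu>' \<nu>'"
  shows "transport_cost p \<mu> \<nu> = transport_cost p \<mu>' \<nu>'"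
proof -
  have "enn2real (transport_cost p \<mu> \<nu>) powr (1 / p) = enn2real (transport_cost p \<mu>' \<nu>') powr (1 / p)"
    using eq by (simp add: wasserstein_dist_def transport_cost_def)
  then have "(enn2real (transport_cost p \<mu> \<nu>) powr (1 / p)) powr p
      = (enn2real (transport_cost p \<mu>' \<nu>') powr (1 / p)) powr p" by simp
  then have "enn2real (transport_cost p \<mu> \<nu>) = enn2real (transport_cost p \<mu>' \<nu>')"
    using \<open>p > 0\<close> by (simp add: powr_powr)
  then have "ennreal (enn2real (transport_cost p \<mu> \<nu>)) = ennreal (enn2real (transport_cost p \<mu>' \<nu>'))" by simp
  then show ?thesis
    using transport_cost_finite assms(1-4) by (metis ennreal_enn2real infinity_ennreal_def)
qed

section \<open>Dirac measures, push-forwards and their costs\<close>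

lemma return_in_wasserstein_space:
  fixes x :: "'a::{real_normed_vector, second_countable_topology}"
  shows "return borel x \<in> Wasserstein_space p"
  by (auto simp: Wasserstein_space_def prob_space_return nn_integral_return)

lemma distr_in_wasserstein_space:
  fixes T :: "'a \<Rightarrow> 'a::{real_normed_vector, second_countable_topology}"
  assumes "\<mu> \<in> Wasserstein_space p" "T \<in> borel_measurable borel"
    and C: "\<And>x. norm (T x) \<le> C * norm x + D"
  shows "distr \<mu> borel T \<in> Wasserstein_space p"
proof -
  note [simp] = measurable_wasserstein_space[OF assms(1)]
  note [measurable] = assms(2)
  interpret prob_space \<mu> by (rule wasserstein_spaceD[OF assms(1)])
  have "integrable \<mu> (\<lambda>x. norm (T x) ^ p)"
  proof (rule Bochner_Integration.integrable_bound)
    show "integrable \<mu> (\<lambda>x. 2 ^ p * (\<bar>C\<bar> ^ p * norm (x - 0) ^ p + \<bar>D\<bar> ^ p))"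
      using wasserstein_space_integrable[OF assms(1), of 0] by auto
    have "norm (T x) ^ p \<le> 2 ^ p * (\<bar>C\<bar> ^ p * norm (x - 0) ^ p + \<bar>D\<bar> ^ p)" for x
    proof -
      \<comment> \<open>The sum is written as a difference so that \<open>norm_diff_power_le\<close>
        applies to it.\<close>
      have "norm (T x) \<le> norm (\<bar>C\<bar> * norm x - (- \<bar>D\<bar>))"
        using C[of x] mult_right_mono[OF abs_ge_self[of C] norm_ge_zero[of x]] by simp
      then have "norm (T x) ^ p \<le> norm (\<bar>C\<bar> * norm x - (- \<bar>D\<bar>)) ^ p" by (intro power_mono) auto
      also have "\<dots> \<le> 2 ^ p * (norm (\<bar>C\<bar> * norm x) ^ p + norm (- \<bar>D\<bar>) ^ p)" by (rule norm_diff_power_le)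
      finally show ?thesis by (simp add: power_mult_distrib abs_mult)
    qed
    then show "AE x in \<mu>. norm (norm (T x) ^ p) \<le> norm (2 ^ p * (\<bar>C\<bar> ^ p * norm (x - 0) ^ p + \<bar>D\<bar> ^ p))" by auto
  qed simp
  then show ?thesis
    by (auto simp: Wasserstein_space_def nn_integral_distr prob_space_distr integrable_iff_bounded)
qed

text \<open>Every coupling has first coordinate \<open>x\<close> almost everywhere, so all couplings
  have the same cost and the infimum runs over a constant.\<close>

lemma transport_cost_return_left:
  fixes x :: "'a::{real_normed_vector, second_countable_topology}"
  assumes "\<mu> \<in> Wasserstein_space p"
  shows "transport_cost p (return borel x) \<mu> = (\<integral>\<^sup>+ y. ennreal (norm (y - x) ^ p) \<partial>\<mu>)"
proof -
  have "(\<integral>\<^sup>+ z. ennreal (norm (fst z - snd z) ^ p) \<partial>\<pi>) = (\<integral>\<^sup>+ y. ennreal (norm (y - x) ^ p) \<partial>\<mu>)"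
    if \<pi>: "\<pi> \<in> couplings (return borel x) \<mu>" for \<pi>
  proof -
    have "AE y in return borel x. y = x" by (subst AE_return) auto
    then have "AE z in \<pi>. fst z = x" using AE_coupling(1)[OF \<pi>, of "\<lambda>y. y = x"] by simp
    then have "(\<integral>\<^sup>+ z. ennreal (norm (fst z - snd z) ^ p) \<partial>\<pi>) = (\<integral>\<^sup>+ z. ennreal (norm (snd z - x) ^ p) \<partial>\<pi>)"
      by (intro nn_integral_cong_AE) (auto simp: norm_minus_commute)
    then show ?thesis using nn_integral_coupling(2)[OF \<pi>, of "\<lambda>y. ennreal (norm (y - x) ^ p)"] by simp
  qed
  moreover have "couplings (return borel x) \<mu> \<noteq> {}"
    using pair_measure_in_couplings[OF return_in_wasserstein_space assms] by auto
  ultimately show ?thesis unfolding transport_cost_def by simp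
qed

lemma transport_cost_return_right:
  fixes x :: "'a::{real_normed_vector, second_countable_topology}"
  assumes "\<mu> \<in> Wasserstein_space p"
  shows "transport_cost p \<mu> (return borel x) = (\<integral>\<^sup>+ y. ennreal (norm (y - x) ^ p) \<partial>\<mu>)"
  using transport_cost_return_left[OF assms] transport_cost_commute by metis

text \<open>Pushing a coupling forward by \<open>g\<close> in both coordinates keeps its cost. The
  reverse inequality, for bijective \<open>g\<close>, comes from applying this to the
  inverse.\<close>

lemma transport_cost_distr_isometry_le:
  fixes g :: "'a \<Rightarrow> 'a::{real_normed_vector, second_countable_topology}"
  assumes g: "\<And>x y. dist (g x) (g y) = dist x y"
  shows "transport_cost p (distr \<mu> borel g) (distr \<nu> borel g) \<le> transport_cost p \<mu> \<nu>"
  unfolding transport_cost_def[of p \<mu> \<nu>]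
proof (rule INF_greatest)
  fix \<pi> assume \<pi>: "\<pi> \<in> couplings \<mu> \<nu>"
  have "continuous_on UNIV g" using g by (auto simp: continuous_on_iff)
  then have gm [measurable]: "g \<in> borel_measurable borel" by (rule borel_measurable_continuous_onI)
  note [measurable] = couplings_measurable[OF \<pi>]
  have eq: "distr \<pi> borel (\<lambda>z. g (fst z)) = distr \<mu> borel g" "distr \<pi> borel (\<lambda>z. g (snd z)) = distr \<nu> borel g"
    using distr_distr[OF gm, of fst \<pi>] distr_distr[OF gm, of snd \<pi>]
    by (simp_all add: comp_def couplingsD(3,4)[OF \<pi>] couplings_measurable[OF \<pi>])
  show "transport_cost p (distr \<mu> borel g) (distr \<nu> borel g) \<le> (\<integral>\<^sup>+ z. ennreal (norm (fst z - snd z) ^ p) \<partial>\<pi>)"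
    using transport_cost_distr_le[OF couplingsD(2)[OF \<pi>], of "\<lambda>z. g (fst z)" "\<lambda>z. g (snd z)" p] g
    by (simp add: eq dist_norm)
qed

section \<open>Dirac measures\<close>

text \<open>The power mean inequality with constant \<open>2 ^ (k - 1)\<close>, doubled on both
  sides to avoid the subtraction. The induction step rests on \<open>a ^ k - b ^ k\<close> and
  \<open>a - b\<close> having the same sign.\<close>

lemma sum_power_le:
  fixes a b :: real
  assumes "a \<ge> 0" "b \<ge> 0"
  shows "2 * (a + b) ^ k \<le> 2 ^ k * (a ^ k + b ^ k)"
proof (induction k)
  case (Suc k)
  have "(a ^ k - b ^ k) * (a - b) \<ge> 0"
    using assms power_mono[of a b k] power_mono[of b a k] by (simp add: zero_le_mult_iff) linarith
  then have "(a ^ k + b ^ k) * (a + b) \<le> 2 * (a ^ Suc k + b ^ Suc k)"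
    by (simp add: algebra_simps)
  then have 1: "2 ^ k * ((a ^ k + b ^ k) * (a + b)) \<le> 2 ^ k * (2 * (a ^ Suc k + b ^ Suc k))"
    by (intro mult_left_mono) auto
  have "2 * (a + b) ^ Suc k = (2 * (a + b) ^ k) * (a + b)" by simp
  also have "\<dots> \<le> (2 ^ k * (a ^ k + b ^ k)) * (a + b)"
    using Suc assms by (intro mult_right_mono) auto
  also have "\<dots> \<le> 2 ^ Suc k * (a ^ Suc k + b ^ Suc k)" using 1 by (simp only: power_Suc mult_ac)
  finally show ?case .
qed simp

text \<open>Since \<open>p\<close> is even, the norm enters only through its square. The
  parallelogram law bounds the squared norm of \<open>y - z\<close>, losing exactly the squared norm
  of \<open>y + z\<close>, and the power mean inequality does the rest. The loss gives strictness
  unless \<open>y = - z\<close>; this equality case identifies Dirac measures.\<close>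

lemma norm_diff_power_le_sharp:
  fixes y z :: "'a::real_inner"
  assumes "even p"
  shows "2 * norm (y - z) ^ p \<le> 2 ^ p * (norm y ^ p + norm z ^ p)"
    and "p > 0 \<Longrightarrow> y \<noteq> - z \<Longrightarrow> 2 * norm (y - z) ^ p < 2 ^ p * (norm y ^ p + norm z ^ p)"
proof -
  obtain k where k: "p = 2 * k" using assms by blast
  have par: "(norm (y - z))\<^sup>2 = 2 * ((norm y)\<^sup>2 + (norm z)\<^sup>2) - (norm (y + z))\<^sup>2"
    by (simp add: power2_norm_eq_inner algebra_simps inner_commute)
  have *: "2 * (2 * ((norm y)\<^sup>2 + (norm z)\<^sup>2)) ^ k \<le> 2 ^ p * (norm y ^ p + norm z ^ p)"
  proof -
    have "2 * (2 * ((norm y)\<^sup>2 + (norm z)\<^sup>2)) ^ k = 2 ^ k * (2 * ((norm y)\<^sup>2 + (norm z)\<^sup>2) ^ k)"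
      by (simp only: power_mult_distrib mult_ac)
    also have "\<dots> \<le> 2 ^ k * (2 ^ k * (((norm y)\<^sup>2) ^ k + ((norm z)\<^sup>2) ^ k))"
      by (intro mult_left_mono sum_power_le) auto
    also have "\<dots> = 2 ^ p * (norm y ^ p + norm z ^ p)"
      unfolding k power_mult[of "norm _"] by (simp only: mult_2 power_add mult.assoc)
    finally show ?thesis .
  qed
  have "(norm (y - z))\<^sup>2 \<le> 2 * ((norm y)\<^sup>2 + (norm z)\<^sup>2)"
    using par zero_le_power2[of "norm (y + z)"] by linarith
  then have "((norm (y - z))\<^sup>2) ^ k \<le> (2 * ((norm y)\<^sup>2 + (norm z)\<^sup>2)) ^ k"
    by (intro power_mono) auto
  then have "norm (y - z) ^ p \<le> (2 * ((norm y)\<^sup>2 + (norm z)\<^sup>2)) ^ k" by (simp add: k power_mult)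
  with * show "2 * norm (y - z) ^ p \<le> 2 ^ p * (norm y ^ p + norm z ^ p)" by linarith
  assume "p > 0" "y \<noteq> - z"
  then have "norm (y + z) > 0" by (auto simp: add_eq_0_iff2)
  then have "(norm (y - z))\<^sup>2 < 2 * ((norm y)\<^sup>2 + (norm z)\<^sup>2)" using par zero_less_power[of "norm (y + z)" 2] by linarith
  then have "((norm (y - z))\<^sup>2) ^ k < (2 * ((norm y)\<^sup>2 + (norm z)\<^sup>2)) ^ k"
    using \<open>p > 0\<close> k by (intro power_strict_mono) auto
  then have "norm (y - z) ^ p < (2 * ((norm y)\<^sup>2 + (norm z)\<^sup>2)) ^ k" by (simp add: k power_mult)
  with * show "2 * norm (y - z) ^ p < 2 ^ p * (norm y ^ p + norm z ^ p)" by linarith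
qed

lemma AE_eq_imp_return:
  fixes \<mu> :: "'a::t2_space measure"
  assumes "sets \<mu> = sets borel" "prob_space \<mu>" "AE y in \<mu>. y = x"
  shows "\<mu> = return borel x"
proof (rule measure_eqI)
  interpret prob_space \<mu> by fact
  fix A assume A: "A \<in> sets \<mu>"
  have "emeasure \<mu> A = emeasure \<mu> (if x \<in> A then space \<mu> else {})"
    using assms A by (intro emeasure_eq_AE) (auto split: if_splits)
  then show "emeasure \<mu> A = emeasure (return borel x) A"
    using A assms(1) by (auto simp: emeasure_space_1)
qed (simp add: assms)

text \<open>Says that every \<open>a\<close> is the midpoint of \<open>\<mu>\<close> and some \<open>b\<close>; this characterises
  Dirac measures in terms of the metric alone.\<close>

definition extendable_from ::
  "nat \<Rightarrow> ('a::{real_normed_vector, second_countable_topology}) measure \<Rightarrow> bool" where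
  "extendable_from p \<mu> \<longleftrightarrow> (\<forall>a\<in>Wasserstein_space p. \<exists>b\<in>Wasserstein_space p.
     transport_cost p a b \<le> transport_cost p \<mu> a \<and>
     2 ^ p * transport_cost p \<mu> a \<le> transport_cost p \<mu> b)"

text \<open>The witness is the image of \<open>a\<close> under the dilation by the factor 2 about
  \<open>x\<close>: it moves each \<open>y\<close> by exactly its distance to \<open>x\<close> and
  doubles that distance.\<close>

lemma extendable_from_return:
  fixes x :: "'a::{real_normed_vector, second_countable_topology}"
  shows "extendable_from p (return borel x)"
  unfolding extendable_from_def
proof
  fix a :: "'a measure" assume a: "a \<in> Wasserstein_space p"
  define T where "T y = 2 *\<^sub>R y - x" for y :: 'a
  have T: "T \<in> borel_measurable borel"
    unfolding T_def by (intro borel_measurable_continuous_onI continuous_intros)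
  have b: "distr a borel T \<in> Wasserstein_space p"
  proof (rule distr_in_wasserstein_space[OF a T])
    show "norm (T y) \<le> 2 * norm y + norm x" for y
      unfolding T_def using norm_triangle_ineq4[of "2 *\<^sub>R y" x] by simp
  qed
  have "norm (y - T y) = norm (y - x)" for y
    by (simp add: T_def scaleR_2 norm_minus_commute algebra_simps)
  then have 1: "transport_cost p a (distr a borel T) \<le> transport_cost p (return borel x) a"
    using transport_cost_map_le[OF a T, of p] by (simp add: transport_cost_return_left[OF a])
  have n: "norm (T y - x) ^ p = 2 ^ p * norm (y - x) ^ p" for y
  proof -
    have "T y - x = 2 *\<^sub>R (y - x)" by (simp add: T_def scaleR_2 algebra_simps)
    then show ?thesis by (simp add: power_mult_distrib)
  qed
  have "transport_cost p (return borel x) (distr a borel T) = (\<integral>\<^sup>+ y. ennreal (norm (T y - x) ^ p) \<partial>a)"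
    using T by (subst transport_cost_return_left[OF b], subst nn_integral_distr)
       (simp_all add: measurable_wasserstein_space[OF a])
  also have "\<dots> = 2 ^ p * (\<integral>\<^sup>+ y. ennreal (norm (y - x) ^ p) \<partial>a)"
    by (subst nn_integral_cmult[symmetric]) (auto simp: n ennreal_mult measurable_wasserstein_space[OF a] simp flip: ennreal_power)
  finally have 2: "2 ^ p * transport_cost p (return borel x) a \<le> transport_cost p (return borel x) (distr a borel T)"
    by (simp add: transport_cost_return_left[OF a])
  show "\<exists>b\<in>Wasserstein_space p. transport_cost p a b \<le> transport_cost p (return borel x) a \<and>
      2 ^ p * transport_cost p (return borel x) a \<le> transport_cost p (return borel x) b"
    using 1 2 b by blast
qed

text \<open>Testing with \<open>a\<close> the Dirac measure at \<open>0\<close> gives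
  \<open>\<nu>\<close> with moments \<open>B \<le> A\<close>. The product coupling costs at least
  \<open>2 ^ p * A\<close>, while the sharp inequality allows at most
  \<open>2 ^ p * (A + B) / 2\<close>. So equality holds almost everywhere, forcing
  \<open>y = - z\<close> for almost all pairs.\<close>

lemma extendable_from_imp_return:
  fixes \<mu> :: "'a::{real_inner, second_countable_topology} measure"
  assumes "even p" "p > 0" and \<mu>: "\<mu> \<in> Wasserstein_space p" and ext: "extendable_from p \<mu>"
  obtains x where "\<mu> = return borel x"
proof -
  obtain \<nu> where \<nu>: "\<nu> \<in> Wasserstein_space p"
    and 1: "transport_cost p (return borel 0) \<nu> \<le> transport_cost p \<mu> (return borel 0)"
    and 2: "2 ^ p * transport_cost p \<mu> (return borel 0) \<le> transport_cost p \<mu> \<nu>"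
    using ext return_in_wasserstein_space unfolding extendable_from_def by blast
  interpret M: prob_space \<mu> by (rule wasserstein_spaceD[OF \<mu>])
  interpret N: prob_space \<nu> by (rule wasserstein_spaceD[OF \<nu>])
  interpret pair_prob_space \<mu> \<nu> ..
  let ?\<pi> = "\<mu> \<Otimes>\<^sub>M \<nu>"
  define A where "A = (\<integral>y. norm y ^ p \<partial>\<mu>)"
  define B where "B = (\<integral>y. norm y ^ p \<partial>\<nu>)"
  note c = pair_measure_in_couplings[OF \<mu> \<nu>]
  note [measurable] = couplings_measurable[OF c]
  have [measurable]: "(\<lambda>y::'a. norm y ^ p) \<in> borel_measurable borel" by simp
  have i: "integrable \<mu> (\<lambda>y. norm y ^ p)" "integrable \<nu> (\<lambda>y. norm y ^ p)"
    using wasserstein_space_integrable[OF \<mu>, of 0] wasserstein_space_integrable[OF \<nu>, of 0] by simp_all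
  have ip: "integrable ?\<pi> (\<lambda>z. norm (fst z) ^ p)" "integrable ?\<pi> (\<lambda>z. norm (snd z) ^ p)"
    using integrable_coupling(1,2)[OF c, of "\<lambda>y. norm y ^ p"] i by simp_all
  have pint: "(\<integral>z. norm (fst z) ^ p \<partial>?\<pi>) = A" "(\<integral>z. norm (snd z) ^ p \<partial>?\<pi>) = B"
    using integrable_coupling(3,4)[OF c, of "\<lambda>y. norm y ^ p"] by (simp_all add: A_def B_def)
  \<comment> \<open>The defect in the sharp inequality: nonnegative pointwise, and shown below to
    have integral at most \<open>0\<close>.\<close>
  let ?g = "\<lambda>z. 2 ^ p * (norm (fst z) ^ p + norm (snd z) ^ p) - 2 * norm (fst z - snd z) ^ p"
  have id: "integrable ?\<pi> (\<lambda>z. norm (fst z - snd z) ^ p)"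
  proof (rule Bochner_Integration.integrable_bound)
    show "integrable ?\<pi> (\<lambda>z. 2 ^ p * (norm (fst z) ^ p + norm (snd z) ^ p))" using ip by auto
    show "AE z in ?\<pi>. norm (norm (fst z - snd z) ^ p) \<le> norm (2 ^ p * (norm (fst z) ^ p + norm (snd z) ^ p))"
      using norm_diff_power_le by auto
  qed simp
  have AB: "A \<ge> 0" "B \<ge> 0" by (auto simp: A_def B_def)
  have "B \<le> A"
    using 1 AB unfolding transport_cost_return_left[OF \<nu>] transport_cost_return_right[OF \<mu>]
      wasserstein_space_nn_integral[OF \<mu>] wasserstein_space_nn_integral[OF \<nu>]
    by (simp add: A_def B_def)
  have "ennreal (2 ^ p * A) = 2 ^ p * transport_cost p \<mu> (return borel 0)"
    unfolding transport_cost_return_right[OF \<mu>] wasserstein_space_nn_integral[OF \<mu>] using AB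
    by (simp add: A_def ennreal_mult flip: ennreal_power)
  also have "\<dots> \<le> (\<integral>\<^sup>+ z. ennreal (norm (fst z - snd z) ^ p) \<partial>?\<pi>)"
    using 2 transport_cost_le[OF c, of p] by simp
  also have "\<dots> = ennreal (\<integral>z. norm (fst z - snd z) ^ p \<partial>?\<pi>)"
    by (rule nn_integral_eq_integral[OF id]) auto
  finally have "2 ^ p * A \<le> (\<integral>z. norm (fst z - snd z) ^ p \<partial>?\<pi>)"
    by (subst (asm) ennreal_le_iff) auto
  moreover have "(\<integral>z. ?g z \<partial>?\<pi>) = 2 ^ p * (A + B) - 2 * (\<integral>z. norm (fst z - snd z) ^ p \<partial>?\<pi>)"
    using ip id by (simp add: pint)
  ultimately have "(\<integral>z. ?g z \<partial>?\<pi>) \<le> 2 ^ p * B - 2 ^ p * A" by (simp add: algebra_simps)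
  also have "\<dots> \<le> 0" using \<open>B \<le> A\<close> by simp
  finally have "(\<integral>z. ?g z \<partial>?\<pi>) \<le> 0" .
  moreover have g0: "?g z \<ge> 0" for z :: "'a \<times> 'a"
    using norm_diff_power_le_sharp(1)[OF \<open>even p\<close>, of "fst z" "snd z"] by simp
  moreover have ig: "integrable ?\<pi> ?g" using ip id by auto
  ultimately have "(\<integral>z. ?g z \<partial>?\<pi>) = 0" by (intro antisym Bochner_Integration.integral_nonneg) auto
  then have "AE z in ?\<pi>. ?g z = 0"
    using integral_nonneg_eq_0_iff_AE[OF ig] g0 by simp
  then have "AE z in ?\<pi>. fst z = - snd z"
  proof (rule eventually_mono)
    show "fst z = - snd z" if "?g z = 0" for z :: "'a \<times> 'a"
      using that norm_diff_power_le_sharp(2)[OF \<open>even p\<close> \<open>p > 0\<close>, of "fst z" "snd z"]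
      by (cases "fst z = - snd z") simp_all
  qed
  \<comment> \<open>By Fubini, almost every \<open>y\<close> is the negative of
    \<open>\<nu>\<close>-almost every \<open>z\<close>. Any two such \<open>y\<close> share some
    \<open>z\<close>, hence coincide.\<close>
  from AE_pair[OF this] have ae: "AE y in \<mu>. AE z in \<nu>. y = - z" by simp
  then obtain x where x: "AE z in \<nu>. x = - z"
    using eventually_happens'[OF M.ae_filter_bot] by blast
  from ae have "AE y in \<mu>. y = x"
  proof (rule eventually_mono)
    fix y assume "AE z in \<nu>. y = - z"
    with x have "AE z in \<nu>. y = x" by eventually_elim simp
    then show "y = x" using eventually_happens'[OF N.ae_filter_bot] by blast
  qed
  then show ?thesis
    using AE_eq_imp_return wasserstein_spaceD[OF \<mu>] that by blast
qed

section \<open>Measures on two points\<close>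

text \<open>Integrability is included because a Bochner integral of a non-integrable function is
  \<open>0\<close>; bare equality of integrals would not pass to sums and differences.\<close>

definition same_integral :: "'a measure \<Rightarrow> 'a measure \<Rightarrow> ('a \<Rightarrow> real) \<Rightarrow> bool" where
  "same_integral \<mu> \<nu> f \<longleftrightarrow> integrable \<mu> f \<and> integrable \<nu> f \<and> integral\<^sup>L \<mu> f = integral\<^sup>L \<nu> f"

lemma same_integral_diff:
  "same_integral \<mu> \<nu> f \<Longrightarrow> same_integral \<mu> \<nu> g \<Longrightarrow> same_integral \<mu> \<nu> (\<lambda>y. f y - g y)"
  by (auto simp: same_integral_def)

lemma same_integral_cmult:
  "same_integral \<mu> \<nu> f \<Longrightarrow> same_integral \<mu> \<nu> (\<lambda>y. r * f y)"
  by (auto simp: same_integral_def)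

lemma same_integral_sum:
  "(\<And>i. i \<in> I \<Longrightarrow> same_integral \<mu> \<nu> (f i)) \<Longrightarrow> same_integral \<mu> \<nu> (\<lambda>y. \<Sum>i\<in>I. f i y)"
  by (auto simp: same_integral_def intro!: sum.cong)

lemma same_integral_const:
  "prob_space \<mu> \<Longrightarrow> prob_space \<nu> \<Longrightarrow> same_integral \<mu> \<nu> (\<lambda>y. r)"
  using prob_space.prob_space[of \<mu>] prob_space.prob_space[of \<nu>]
  by (auto simp: same_integral_def prob_space_def intro!: finite_measure.integrable_const)

text \<open>The coefficients are recovered as linear combinations of values at several arguments, so
  their integrability is obtained along with the equality of integrals and need not be known
  beforehand.\<close>

lemma same_integral_coeff:
  assumes "\<And>t::real. same_integral \<mu> \<nu> (\<lambda>y. \<Sum>i\<le>n. c i y * t ^ i)" and "i \<le> n"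
  shows "same_integral \<mu> \<nu> (c i)"
  using assms
proof (induction n arbitrary: c i)
  case 0
  then show ?case using "0.prems"(1)[of 1] by simp
next
  case (Suc n)
  \<comment> \<open>Substituting \<open>2 * t\<close> for \<open>t\<close> and subtracting eliminates the top coefficient.\<close>
  have lower: "same_integral \<mu> \<nu> (c j)" if "j \<le> n" for j
  proof -
    have "same_integral \<mu> \<nu> (\<lambda>y. \<Sum>i\<le>n. ((2 ^ i - 2 ^ Suc n) * c i y) * t ^ i)" for t
    proof -
      have "same_integral \<mu> \<nu>
          (\<lambda>y. (\<Sum>i\<le>Suc n. c i y * (2 * t) ^ i) - 2 ^ Suc n * (\<Sum>i\<le>Suc n. c i y * t ^ i))"
        using Suc.prems(1) by (intro same_integral_diff same_integral_cmult)
      moreover have "(\<Sum>i\<le>Suc n. c i y * (2 * t) ^ i) - 2 ^ Suc n * (\<Sum>i\<le>Suc n. c i y * t ^ i)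
          = (\<Sum>i\<le>n. ((2 ^ i - 2 ^ Suc n) * c i y) * t ^ i)" for y
      proof -
        have "(\<Sum>i\<le>Suc n. c i y * (2 * t) ^ i) - 2 ^ Suc n * (\<Sum>i\<le>Suc n. c i y * t ^ i)
            = (\<Sum>i\<le>Suc n. ((2 ^ i - 2 ^ Suc n) * c i y) * t ^ i)"
          unfolding sum_distrib_left sum_subtractf[symmetric]
          by (intro sum.cong) (auto simp: power_mult_distrib algebra_simps)
        then show ?thesis by simp
      qed
      ultimately show ?thesis by simp
    qed
    from same_integral_cmult[OF Suc.IH[OF this that], of "inverse (2 ^ j - 2 ^ Suc n)"]
    show ?thesis
      using power_strict_increasing[of j "Suc n" "2::real"] that by (simp add: mult.assoc[symmetric])
  qed
  show ?case
  proof (cases "i \<le> n")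
    case False
    with Suc.prems have i: "i = Suc n" by simp
    \<comment> \<open>The value at \<open>1\<close> minus all lower coefficients is the top
      coefficient.\<close>
    have "same_integral \<mu> \<nu> (\<lambda>y. (\<Sum>i\<le>Suc n. c i y * 1 ^ i) - (\<Sum>i\<le>n. c i y))"
      by (rule same_integral_diff[OF Suc.prems(1) same_integral_sum]) (simp add: lower)
    then show ?thesis by (simp add: i)
  qed (rule lower)
qed

text \<open>With \<open>a\<close> the inner product of a unit vector \<open>u\<close> with
  \<open>y - c\<close> and \<open>b\<close> the squared norm of \<open>y - c\<close>, the quadratic
  at \<open>t\<close> is the squared norm of \<open>u - t *\<^sub>R (y - c)\<close>. Its
  coefficients are therefore moments of \<open>y - c\<close>. The factors \<open>real k - 1\<close>
  and so on are real, so small \<open>k\<close> needs no separate treatment.\<close>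

lemma coeff_quadratic_power:
  fixes a b :: real and k :: nat
  defines "q \<equiv> [:1, - 2 * a, b:] ^ k"
  shows "poly.coeff q 1 = - 2 * k * a"
    and "poly.coeff q 2 = k * b + 2 * k * (real k - 1) * a\<^sup>2"
    and "poly.coeff q 4 = k * (real k - 1) / 2 * b\<^sup>2 + 2 * k * (real k - 1) * (real k - 2) * a\<^sup>2 * b
          + 2 / 3 * k * (real k - 1) * (real k - 2) * (real k - 3) * a ^ 4"
proof -
  \<comment> \<open>Coefficients \<open>0\<close> and \<open>3\<close> are carried along because
    each coefficient recurs on the two before it.\<close>
  have "poly.coeff q 0 = 1 \<and> poly.coeff q 1 = - 2 * k * a \<and> poly.coeff q 2 = k * b + 2 * k * (real k - 1) * a\<^sup>2 \<and>
    poly.coeff q 3 = - 2 * k * (real k - 1) * a * b - 4 / 3 * k * (real k - 1) * (real k - 2) * a ^ 3 \<and>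
    poly.coeff q 4 = k * (real k - 1) / 2 * b\<^sup>2 + 2 * k * (real k - 1) * (real k - 2) * a\<^sup>2 * b
          + 2 / 3 * k * (real k - 1) * (real k - 2) * (real k - 3) * a ^ 4"
    unfolding q_def
  proof (induction k)
    case (Suc k)
    \<comment> \<open>The recurrence from one more factor; the conditionals keep truncated
      subtraction at indices \<open>0\<close> and \<open>1\<close> from picking up a wrong
      coefficient.\<close>
    have rec: "poly.coeff ([:1, - 2 * a, b:] ^ Suc k) n = poly.coeff ([:1, - 2 * a, b:] ^ k) n
       + (if n = 0 then 0 else - 2 * a * poly.coeff ([:1, - 2 * a, b:] ^ k) (n - 1))
       + (if n \<le> 1 then 0 else b * poly.coeff ([:1, - 2 * a, b:] ^ k) (n - 2))" for n
      by (cases n; cases "n - 1") (auto simp: Polynomial.coeff_pCons)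
    let ?c = "poly.coeff ([:1, - 2 * a, b:] ^ k)" and ?d = "poly.coeff ([:1, - 2 * a, b:] ^ Suc k)"
    have "?d 0 = ?c 0" "?d 1 = ?c 1 - 2 * a * ?c 0" "?d 2 = ?c 2 - 2 * a * ?c 1 + b * ?c 0"
      "?d 3 = ?c 3 - 2 * a * ?c 2 + b * ?c 1" "?d 4 = ?c 4 - 2 * a * ?c 3 + b * ?c 2"
      by (simp_all only: rec) simp_all
    moreover have "?c 0 = 1" "?c 1 = - 2 * k * a" "?c 2 = k * b + 2 * k * (real k - 1) * a\<^sup>2"
      "?c 3 = - 2 * k * (real k - 1) * a * b - 4 / 3 * k * (real k - 1) * (real k - 2) * a ^ 3"
      "?c 4 = k * (real k - 1) / 2 * b\<^sup>2 + 2 * k * (real k - 1) * (real k - 2) * a\<^sup>2 * b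
          + 2 / 3 * k * (real k - 1) * (real k - 2) * (real k - 3) * a ^ 4"
      using Suc by simp_all
    ultimately show ?case
      by (simp only:) (simp add: field_simps power2_eq_square power3_eq_cube power4_eq_xxxx)
  qed (simp add: eval_nat_numeral)
  then show "poly.coeff q 1 = - 2 * k * a"
    and "poly.coeff q 2 = k * b + 2 * k * (real k - 1) * a\<^sup>2"
    and "poly.coeff q 4 = k * (real k - 1) / 2 * b\<^sup>2 + 2 * k * (real k - 1) * (real k - 2) * a\<^sup>2 * b
          + 2 / 3 * k * (real k - 1) * (real k - 2) * (real k - 3) * a ^ 4"
    by simp_all
qed

lemma measure_eqI_finite_support:
  fixes \<mu> \<nu> :: "'a::t2_space measure"
  assumes "sets \<mu> = sets borel" "sets \<nu> = sets borel" "prob_space \<mu>" "prob_space \<nu>" "finite S"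
    and "AE y in \<mu>. y \<in> S" "AE y in \<nu>. y \<in> S"
    and "\<And>x. x \<in> S \<Longrightarrow> measure \<mu> {x} = measure \<nu> {x}"
  shows "\<mu> = \<nu>"
proof (rule measure_eqI)
  interpret M: prob_space \<mu> by fact
  interpret N: prob_space \<nu> by fact
  fix A assume A: "A \<in> sets \<mu>"
  have [simp]: "B \<in> sets borel" if "finite B" for B :: "'a set"
    using that by (intro borel_closed finite_imp_closed)
  have fin: "finite (A \<inter> S)" using assms by simp
  have "emeasure \<mu> A = emeasure \<mu> (A \<inter> S)"
    using assms A fin by (intro emeasure_eq_AE) (auto elim!: eventually_mono)
  also have "\<dots> = (\<Sum>x\<in>A \<inter> S. emeasure \<mu> {x})"
    using fin assms by (intro emeasure_eq_sum_singleton) auto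
  also have "\<dots> = (\<Sum>x\<in>A \<inter> S. emeasure \<nu> {x})"
    using assms by (intro sum.cong) (auto simp: M.emeasure_eq_measure N.emeasure_eq_measure)
  also have "\<dots> = emeasure \<nu> (A \<inter> S)"
    using fin assms by (intro emeasure_eq_sum_singleton[symmetric]) auto
  also have "\<dots> = emeasure \<nu> A"
    using assms A fin by (intro emeasure_eq_AE) (auto elim!: eventually_mono)
  finally show "emeasure \<mu> A = emeasure \<nu> A" .
qed (simp add: assms)

lemma (in prob_space) integral_AE_const:
  fixes f :: "'a \<Rightarrow> real"
  assumes "AE y in M. f y = r" "f \<in> borel_measurable M"
  shows "integral\<^sup>L M f = r"
  using integral_cong_AE[OF assms(2), of "\<lambda>_. r"] assms(1) prob_space by simp

text \<open>For \<open>s \<noteq> 0\<close> the norm of \<open>u - s *\<^sub>R (y - c)\<close> is a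
  multiple of the distance from \<open>y\<close> to \<open>c + (1 / s) *\<^sub>R u\<close>.
  Potentials along the line through \<open>c\<close> in direction \<open>u\<close> thus give a
  polynomial in \<open>s\<close> whose coefficient of \<open>s ^ i\<close> is homogeneous of degree
  \<open>i\<close> in \<open>y - c\<close>.\<close>

lemma same_integral_directional:
  fixes \<mu> \<nu> :: "'a::{real_inner, second_countable_topology} measure"
  assumes \<mu>: "\<mu> \<in> Wasserstein_space (2 * k)" and \<nu>: "\<nu> \<in> Wasserstein_space (2 * k)"
    and pot: "\<And>x. (\<integral>y. norm (y - x) ^ (2 * k) \<partial>\<mu>) = (\<integral>y. norm (y - x) ^ (2 * k) \<partial>\<nu>)"
    and u: "norm u = 1" and i: "i \<le> 2 * k"
  shows "same_integral \<mu> \<nu> (\<lambda>y. poly.coeff ([:1, - 2 * (u \<bullet> (y - c)), (norm (y - c))\<^sup>2:] ^ k) i)"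
proof (rule same_integral_coeff[OF _ i])
  fix s :: real
  let ?q = "\<lambda>y. [:1, - 2 * (u \<bullet> (y - c)), (norm (y - c))\<^sup>2:]"
  have "degree (?q y ^ k) \<le> 2 * k" for y
    by (rule order_trans[OF degree_power_le]) auto
  then have "(\<Sum>i\<le>2 * k. poly.coeff (?q y ^ k) i * s ^ i) = poly (?q y ^ k) s" for y
    using arg_cong[OF poly_as_sum_of_monoms'[of "?q y ^ k" "2 * k"], of "\<lambda>r. poly r s"]
    by (simp add: poly_sum poly_monom)
  also have "poly (?q y ^ k) s = norm (u - s *\<^sub>R (y - c)) ^ (2 * k)" for y
  proof -
    have "(norm (u - s *\<^sub>R (y - c)))\<^sup>2 = poly (?q y) s"
      using u by (simp add: power2_norm_eq_inner algebra_simps inner_commute norm_eq_1)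
    then show ?thesis by (simp add: power_mult poly_power)
  qed
  finally have eq: "(\<lambda>y. \<Sum>i\<le>2 * k. poly.coeff (?q y ^ k) i * s ^ i) = (\<lambda>y. norm (u - s *\<^sub>R (y - c)) ^ (2 * k))"
    by simp
  show "same_integral \<mu> \<nu> (\<lambda>y. \<Sum>i\<le>2 * k. poly.coeff (?q y ^ k) i * s ^ i)"
    unfolding eq
  \<comment> \<open>At \<open>s = 0\<close> no point of the line corresponds, but the integrand is
    constant.\<close>
  proof (cases "s = 0")
    case True
    then show "same_integral \<mu> \<nu> (\<lambda>y. norm (u - s *\<^sub>R (y - c)) ^ (2 * k))"
      using wasserstein_spaceD(2)[OF \<mu>] wasserstein_spaceD(2)[OF \<nu>] by (simp add: same_integral_const)
  next
    case False
    have n: "norm (u - s *\<^sub>R (y - c)) = \<bar>s\<bar> * norm (y - (c + (1 / s) *\<^sub>R u))" for y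
    proof -
      have "u - s *\<^sub>R (y - c) = (- s) *\<^sub>R (y - (c + (1 / s) *\<^sub>R u))"
        using False by (simp add: algebra_simps)
      then show ?thesis by simp
    qed
    have "same_integral \<mu> \<nu> (\<lambda>y. norm (y - (c + (1 / s) *\<^sub>R u)) ^ (2 * k))"
      using pot wasserstein_space_integrable[OF \<mu>] wasserstein_space_integrable[OF \<nu>]
      by (simp add: same_integral_def)
    from same_integral_cmult[OF this, of "\<bar>s\<bar> ^ (2 * k)"]
    show "same_integral \<mu> \<nu> (\<lambda>y. norm (u - s *\<^sub>R (y - c)) ^ (2 * k))"
      by (simp add: n power_mult_distrib)
  qed
qed

text \<open>Moments of degree 2 put \<open>\<nu>\<close> on the line through \<open>a\<close> and
  \<open>b\<close>. There the moment of degree 4, available since \<open>p \<ge> 4\<close>, makes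
  the squared distance to the midpoint constant, so \<open>\<nu>\<close> lives on
  \<open>{a, b}\<close>. The moment of degree 1 then fixes the two masses.\<close>

lemma two_point_measure_determined:
  fixes \<mu> \<nu> :: "'a::{real_inner, second_countable_topology} measure"
  assumes "even p" "p \<ge> 4" and \<mu>: "\<mu> \<in> Wasserstein_space p" and \<nu>: "\<nu> \<in> Wasserstein_space p"
    and pot: "\<And>x. (\<integral>y. norm (y - x) ^ p \<partial>\<mu>) = (\<integral>y. norm (y - x) ^ p \<partial>\<nu>)"
    and "a \<noteq> b" and supp: "AE y in \<mu>. y \<in> {a, b}"
  shows "\<nu> = \<mu>"
proof -
  obtain k where k: "p = 2 * k" using \<open>even p\<close> by blast
  have k2: "k \<ge> 2" using \<open>p \<ge> 4\<close> k by simp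
  interpret M: prob_space \<mu> by (rule wasserstein_spaceD[OF \<mu>])
  interpret N: prob_space \<nu> by (rule wasserstein_spaceD[OF \<nu>])
  note [simp] = measurable_wasserstein_space[OF \<mu>] measurable_wasserstein_space[OF \<nu>]
  \<comment> \<open>Coordinates in which \<open>a = c - r *\<^sub>R e\<close> and
    \<open>b = c + r *\<^sub>R e\<close> with \<open>e\<close> a unit vector, so that
    \<open>\<beta>\<close> and the square of \<open>\<alpha> e\<close> both equal the square of
    \<open>r\<close> at the two points.\<close>
  define c where "c = (1 / 2) *\<^sub>R (a + b)"
  define r where "r = norm (b - a) / 2"
  define e where "e = (1 / (2 * r)) *\<^sub>R (b - a)"
  have r: "r > 0" using \<open>a \<noteq> b\<close> by (simp add: r_def)
  have e: "norm e = 1" using r \<open>a \<noteq> b\<close> by (simp add: e_def r_def)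
  have re: "r *\<^sub>R e = (1 / 2) *\<^sub>R (b - a)" using r by (simp add: e_def)
  have b: "b - c = r *\<^sub>R e" unfolding re c_def by (simp add: algebra_simps flip: scaleR_add_left)
  have a: "a - c = - (r *\<^sub>R e)" unfolding re c_def by (simp add: algebra_simps flip: scaleR_add_left)
  define \<beta> where "\<beta> y = (norm (y - c))\<^sup>2" for y
  define \<alpha> where "\<alpha> u y = u \<bullet> (y - c)" for u y
  have \<alpha>m [measurable]: "\<alpha> u \<in> borel_measurable borel" for u
    unfolding \<alpha>_def by (intro borel_measurable_continuous_onI continuous_intros)
  have \<beta>m [measurable]: "\<beta> \<in> borel_measurable borel"
    unfolding \<beta>_def by (intro borel_measurable_continuous_onI continuous_intros)
  have CS: "(\<alpha> u y)\<^sup>2 \<le> \<beta> y" if "norm u = 1" for u y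
    using Cauchy_Schwarz_ineq[of u "y - c"] that by (simp add: \<alpha>_def \<beta>_def power2_norm_eq_inner norm_eq_1)
  define K where "K = real k * (real k - 1)"
  have K: "K > 0" using k2 by (simp add: K_def)
  note dir = same_integral_directional[OF \<mu>[unfolded k] \<nu>[unfolded k] pot[unfolded k], where c = c]
  have c1: "same_integral \<mu> \<nu> (\<alpha> e)"
    using same_integral_cmult[OF dir[OF e, of 1], of "- 1 / (2 * k)"] k2
    unfolding coeff_quadratic_power by (simp add: \<alpha>_def[abs_def])
  have c2: "same_integral \<mu> \<nu> (\<lambda>y. k * \<beta> y + 2 * K * (\<alpha> u y)\<^sup>2)" if "norm u = 1" for u
    using dir[OF that, of 2] k2 unfolding coeff_quadratic_power by (simp add: \<alpha>_def \<beta>_def K_def mult.assoc)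
  define L where "L = 2 / 3 * K * ((real k - 2) * (real k - 3))"
  \<comment> \<open>For an integer \<open>k\<close> the product \<open>(k - 2) * (k - 3)\<close> is
    never negative.\<close>
  have L: "L \<ge> 0"
  proof -
    have "k = 2 \<or> k \<ge> 3" using k2 by auto
    then show ?thesis using K by (auto simp: L_def)
  qed
  have c4: "same_integral \<mu> \<nu> (\<lambda>y. K / 2 * (\<beta> y)\<^sup>2 + 2 * K * (real k - 2) * (\<alpha> e y)\<^sup>2 * \<beta> y + L * (\<alpha> e y) ^ 4)"
    using dir[OF e, of 4] k2 unfolding coeff_quadratic_power
    by (simp add: \<alpha>_def \<beta>_def K_def L_def mult.assoc)
  have \<beta>0: "\<beta> y \<ge> 0" for y by (simp add: \<beta>_def)
  have ee: "e \<bullet> e = 1" using e by (simp add: norm_eq_1)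
  have supp\<beta>: "AE y in \<mu>. \<beta> y = r\<^sup>2"
    using supp by eventually_elim (auto simp: \<beta>_def a b e power_mult_distrib)
  have supp\<alpha>: "AE y in \<mu>. (\<alpha> e y)\<^sup>2 = r\<^sup>2"
    using supp by eventually_elim (auto simp: \<alpha>_def a b ee)
  \<comment> \<open>Only the combination from the second coefficient is known to be integrable; both
    its terms are nonnegative, so it dominates \<open>\<beta>\<close>.\<close>
  have i\<beta>: "integrable \<nu> \<beta>"
  proof (rule Bochner_Integration.integrable_bound)
    show "integrable \<nu> (\<lambda>y. k * \<beta> y + 2 * K * (\<alpha> e y)\<^sup>2)" using c2[OF e] by (simp add: same_integral_def)
    have "\<beta> y \<le> k * \<beta> y" for y using k2 \<beta>0[of y] mult_right_mono[of 1 "real k" "\<beta> y"] by simp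
    moreover have "0 \<le> 2 * K * (\<alpha> e y)\<^sup>2" for y using K by simp
    ultimately show "AE y in \<nu>. norm (\<beta> y) \<le> norm (k * \<beta> y + 2 * K * (\<alpha> e y)\<^sup>2)"
      using \<beta>0 by (auto intro!: AE_I2 order_trans[OF _ abs_ge_self] add_increasing2)
  qed simp
  have i\<alpha>: "integrable \<nu> (\<lambda>y. (\<alpha> u y)\<^sup>2)" if "norm u = 1" for u
    using CS[OF that] \<beta>0 by (intro Bochner_Integration.integrable_bound[OF i\<beta>]) auto
  have val: "k * (\<integral>y. \<beta> y \<partial>\<nu>) + 2 * K * (\<integral>y. (\<alpha> u y)\<^sup>2 \<partial>\<nu>) = k * r\<^sup>2 + 2 * K * q"
    if "norm u = 1" "AE y in \<mu>. (\<alpha> u y)\<^sup>2 = q" for u q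
  proof -
    have "k * (\<integral>y. \<beta> y \<partial>\<nu>) + 2 * K * (\<integral>y. (\<alpha> u y)\<^sup>2 \<partial>\<nu>) = (\<integral>y. k * \<beta> y + 2 * K * (\<alpha> u y)\<^sup>2 \<partial>\<nu>)"
      using i\<beta> i\<alpha>[OF that(1)] by simp
    also have "\<dots> = (\<integral>y. k * \<beta> y + 2 * K * (\<alpha> u y)\<^sup>2 \<partial>\<mu>)"
      using c2[OF that(1)] by (simp add: same_integral_def)
    also have "\<dots> = k * r\<^sup>2 + 2 * K * q"
    proof (rule M.integral_AE_const)
      show "AE y in \<mu>. k * \<beta> y + 2 * K * (\<alpha> u y)\<^sup>2 = k * r\<^sup>2 + 2 * K * q"
        using supp\<beta> that(2) by eventually_elim simp
    qed simp
    finally show ?thesis .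
  qed
  have le: "(\<integral>y. (\<alpha> u y)\<^sup>2 \<partial>\<nu>) \<le> (\<integral>y. \<beta> y \<partial>\<nu>)" if "norm u = 1" for u
    using CS[OF that] i\<beta> i\<alpha>[OF that] by (intro integral_mono) auto
  \<comment> \<open>Comparing \<open>e\<close> with a unit vector orthogonal to it shows that \<open>\<nu>\<close> has no variance off the line.\<close>
  have line: "(\<integral>y. \<beta> y \<partial>\<nu>) = (\<integral>y. (\<alpha> e y)\<^sup>2 \<partial>\<nu>)"
  proof (cases "\<exists>u. norm u = 1 \<and> u \<bullet> e = 0")
    case True
    then obtain u where u: "norm u = 1" "u \<bullet> e = 0" by blast
    have "AE y in \<mu>. (\<alpha> u y)\<^sup>2 = 0"
      using supp by eventually_elim (auto simp: \<alpha>_def a b u)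
    from val[OF u(1) this] val[OF e supp\<alpha>]
    have v: "k * (\<integral>y. \<beta> y \<partial>\<nu>) + 2 * K * (\<integral>y. (\<alpha> u y)\<^sup>2 \<partial>\<nu>) = k * r\<^sup>2"
      "k * (\<integral>y. \<beta> y \<partial>\<nu>) + 2 * K * (\<integral>y. (\<alpha> e y)\<^sup>2 \<partial>\<nu>) = k * r\<^sup>2 + 2 * K * r\<^sup>2" by simp_all
    have Y: "(\<integral>y. (\<alpha> u y)\<^sup>2 \<partial>\<nu>) \<ge> 0" by simp
    \<comment> \<open>Subtracting the two identities bounds the second moment along \<open>e\<close>
      below by the square of \<open>r\<close>; the one for \<open>u\<close> bounds the integral of
      \<open>\<beta>\<close> above by it. Cauchy-Schwarz closes the chain.\<close>
    have "2 * K * ((\<integral>y. (\<alpha> e y)\<^sup>2 \<partial>\<nu>) - (\<integral>y. (\<alpha> u y)\<^sup>2 \<partial>\<nu>) - r\<^sup>2) = 0"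
      using v by (simp add: algebra_simps)
    then have X: "(\<integral>y. (\<alpha> e y)\<^sup>2 \<partial>\<nu>) = (\<integral>y. (\<alpha> u y)\<^sup>2 \<partial>\<nu>) + r\<^sup>2" using K by simp
    have "k * (\<integral>y. \<beta> y \<partial>\<nu>) \<le> k * r\<^sup>2" using v(1) Y K mult_nonneg_nonneg[of "2 * K" "\<integral>y. (\<alpha> u y)\<^sup>2 \<partial>\<nu>"] by linarith
    then have "(\<integral>y. \<beta> y \<partial>\<nu>) \<le> r\<^sup>2" using k2 by simp
    with X Y le[OF e] show ?thesis by linarith
  next
    case False
    \<comment> \<open>With no unit vector orthogonal to \<open>e\<close>, the whole space is the
      line spanned by \<open>e\<close>.\<close>
    have "\<beta> y = (\<alpha> e y)\<^sup>2" for y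
    proof -
      define w where "w = (y - c) - \<alpha> e y *\<^sub>R e"
      have "w \<bullet> e = (y - c) \<bullet> e - \<alpha> e y" by (simp add: w_def inner_diff_left ee)
      also have "\<dots> = 0" unfolding \<alpha>_def by (simp only: inner_commute diff_self)
      finally have we: "w \<bullet> e = 0" .
      have "w = 0"
      proof (rule ccontr)
        assume "w \<noteq> 0"
        then have "norm ((1 / norm w) *\<^sub>R w) = 1 \<and> ((1 / norm w) *\<^sub>R w) \<bullet> e = 0" using we by simp
        then show False using False by blast
      qed
      then have "y - c = \<alpha> e y *\<^sub>R e" by (simp add: w_def)
      then have "norm (y - c) = \<bar>\<alpha> e y\<bar>" using e by (metis mult.right_neutral norm_scaleR)
      then show ?thesis by (simp add: \<beta>_def)
    qed
    then show ?thesis by simp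
  qed
  with val[OF e supp\<alpha>] have "(k + 2 * K) * ((\<integral>y. \<beta> y \<partial>\<nu>) - r\<^sup>2) = 0" by (simp add: algebra_simps)
  moreover have "k + 2 * K > 0" using K by (simp add: add_nonneg_pos)
  ultimately have int\<beta>: "(\<integral>y. \<beta> y \<partial>\<nu>) = r\<^sup>2" by (metis less_irrefl mult_eq_0_iff right_minus_eq)
  have "(\<integral>y. \<beta> y - (\<alpha> e y)\<^sup>2 \<partial>\<nu>) = 0" using line i\<beta> i\<alpha>[OF e] by simp
  then have AE1: "AE y in \<nu>. (\<alpha> e y)\<^sup>2 = \<beta> y"
    using integral_nonneg_eq_0_iff_AE[of \<nu> "\<lambda>y. \<beta> y - (\<alpha> e y)\<^sup>2"] i\<beta> i\<alpha>[OF e] CS[OF e] by auto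
  \<comment> \<open>On the line the degree 4 coefficient collapses to \<open>Q\<close> times the
    square of \<open>\<beta>\<close>.\<close>
  define Q where "Q = K / 2 + 2 * K * (real k - 2) + L"
  have Q: "Q > 0" using K L k2 by (simp add: Q_def add_pos_nonneg)
  have poly4: "K / 2 * \<beta>\<^sup>2 + 2 * K * (real k - 2) * \<alpha>\<^sup>2 * \<beta> + L * \<alpha> ^ 4 = Q * \<beta>\<^sup>2"
    if "\<alpha>\<^sup>2 = \<beta>" for \<alpha> \<beta> :: real
  proof -
    have "\<alpha> ^ 4 = \<beta>\<^sup>2" unfolding that[symmetric] by (simp flip: power_mult)
    then show ?thesis unfolding that by (simp add: Q_def power2_eq_square algebra_simps)
  qed
  let ?f = "\<lambda>y. K / 2 * (\<beta> y)\<^sup>2 + 2 * K * (real k - 2) * (\<alpha> e y)\<^sup>2 * \<beta> y + L * (\<alpha> e y) ^ 4"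
  have AE4: "AE y in \<nu>. ?f y = Q * (\<beta> y)\<^sup>2" using AE1 by eventually_elim (rule poly4)
  have i4: "integrable \<nu> ?f" using c4 by (simp add: same_integral_def)
  then have "integrable \<nu> (\<lambda>y. Q * (\<beta> y)\<^sup>2)"
    using integrable_cong_AE[OF _ _ AE4] by simp
  then have i\<beta>2: "integrable \<nu> (\<lambda>y. (\<beta> y)\<^sup>2)" using Q by simp
  have "Q * (\<integral>y. (\<beta> y)\<^sup>2 \<partial>\<nu>) = (\<integral>y. ?f y \<partial>\<nu>)"
    using integral_cong_AE[OF _ _ AE4] by simp
  also have "\<dots> = (\<integral>y. ?f y \<partial>\<mu>)" using c4 by (simp add: same_integral_def)
  also have "\<dots> = Q * (r\<^sup>2)\<^sup>2"
  proof (rule M.integral_AE_const)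
    show "AE y in \<mu>. ?f y = Q * (r\<^sup>2)\<^sup>2"
      using supp\<alpha> supp\<beta>
    proof eventually_elim
      fix y assume y: "(\<alpha> e y)\<^sup>2 = r\<^sup>2" "\<beta> y = r\<^sup>2"
      then have "?f y = Q * (\<beta> y)\<^sup>2" by (intro poly4) simp
      then show "?f y = Q * (r\<^sup>2)\<^sup>2" unfolding y .
    qed
  qed simp
  finally have int\<beta>2: "(\<integral>y. (\<beta> y)\<^sup>2 \<partial>\<nu>) = (r\<^sup>2)\<^sup>2" using Q by simp
  \<comment> \<open>The first two moments of \<open>\<beta>\<close> under \<open>\<nu>\<close> are
    those of a constant, so its variance vanishes.\<close>
  have "(\<beta> y - r\<^sup>2)\<^sup>2 = (\<beta> y)\<^sup>2 - 2 * r\<^sup>2 * \<beta> y + (r\<^sup>2)\<^sup>2" for y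
    by (simp add: power2_diff)
  then have i: "integrable \<nu> (\<lambda>y. (\<beta> y - r\<^sup>2)\<^sup>2)" and "(\<integral>y. (\<beta> y - r\<^sup>2)\<^sup>2 \<partial>\<nu>) = (r\<^sup>2)\<^sup>2 - 2 * r\<^sup>2 * r\<^sup>2 + (r\<^sup>2)\<^sup>2"
    using i\<beta> i\<beta>2 int\<beta> int\<beta>2 N.prob_space by simp_all
  then have "(\<integral>y. (\<beta> y - r\<^sup>2)\<^sup>2 \<partial>\<nu>) = 0" by (simp add: power2_eq_square)
  then have AE2: "AE y in \<nu>. \<beta> y = r\<^sup>2"
    using integral_nonneg_eq_0_iff_AE[OF i] by auto
  have supp\<nu>: "AE y in \<nu>. y \<in> {a, b}"
    using AE1 AE2
  proof eventually_elim
    fix y assume "(\<alpha> e y)\<^sup>2 = \<beta> y" "\<beta> y = r\<^sup>2"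
    \<comment> \<open>Taking for \<open>t\<close> the component of \<open>v\<close> along
      \<open>e\<close> shows that the part of \<open>y - c\<close> orthogonal to \<open>e\<close> is
      zero.\<close>
    have "(norm (v - t *\<^sub>R e))\<^sup>2 = (norm v)\<^sup>2 - 2 * t * (e \<bullet> v) + t\<^sup>2" for v t
      unfolding power2_norm_eq_inner
      by (simp add: inner_diff_left inner_diff_right inner_commute[of v e] ee power2_eq_square algebra_simps)
    from this[of "y - c" "\<alpha> e y"]
    have "(norm ((y - c) - \<alpha> e y *\<^sub>R e))\<^sup>2 = \<beta> y - (\<alpha> e y)\<^sup>2"
      unfolding \<alpha>_def[symmetric] \<beta>_def[symmetric] by (simp add: power2_eq_square)
    with \<open>(\<alpha> e y)\<^sup>2 = \<beta> y\<close> have y: "y - c = \<alpha> e y *\<^sub>R e" by simp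
    from \<open>(\<alpha> e y)\<^sup>2 = \<beta> y\<close> \<open>\<beta> y = r\<^sup>2\<close> have "\<alpha> e y = r \<or> \<alpha> e y = - r" by (simp add: power2_eq_iff)
    with y a b have "y - c = b - c \<or> y - c = a - c" by auto
    then show "y \<in> {a, b}" by auto
  qed
  \<comment> \<open>On \<open>{a, b}\<close> the function \<open>\<alpha> e\<close> takes the values
    \<open>- r\<close> and \<open>r\<close>, so its mean determines both masses.\<close>
  have mass: "measure \<rho> {b} = ((\<integral>y. \<alpha> e y \<partial>\<rho>) / r + 1) / 2" "measure \<rho> {a} = 1 - measure \<rho> {b}"
    if \<rho>: "\<rho> \<in> Wasserstein_space p" "AE y in \<rho>. y \<in> {a, b}" for \<rho>
  proof -
    interpret R: prob_space \<rho> by (rule wasserstein_spaceD[OF \<rho>(1)])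
    note [simp] = measurable_wasserstein_space[OF \<rho>(1)] wasserstein_spaceD(1)[OF \<rho>(1)] wasserstein_spaceD(4)[OF \<rho>(1)]
    have "(\<integral>y. \<alpha> e y \<partial>\<rho>) = (\<integral>y. r * (2 * indicator {b} y - 1) \<partial>\<rho>)"
    proof (rule integral_cong_AE)
      show "AE y in \<rho>. \<alpha> e y = r * (2 * indicator {b} y - 1)"
        using \<rho>(2) by eventually_elim (use \<open>a \<noteq> b\<close> in \<open>auto simp: \<alpha>_def a b ee\<close>)
    qed simp_all
    also have "\<dots> = r * (2 * measure \<rho> {b} - 1)"
      using R.prob_space by (simp add: R.emeasure_eq_measure)
    finally show "measure \<rho> {b} = ((\<integral>y. \<alpha> e y \<partial>\<rho>) / r + 1) / 2" using r by (simp add: field_simps)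
    have "measure \<rho> {a} = measure \<rho> (space \<rho> - {b})"
      using \<rho>(2) \<open>a \<noteq> b\<close> by (intro R.finite_measure_eq_AE) (auto elim!: eventually_mono)
    then show "measure \<rho> {a} = 1 - measure \<rho> {b}" using R.prob_compl[of "{b}"] by simp
  qed
  show ?thesis
    using c1 mass[OF \<mu> supp] mass[OF \<nu> supp\<nu>] wasserstein_spaceD[OF \<mu>] wasserstein_spaceD[OF \<nu>]
    by (intro measure_eqI_finite_support[where S = "{a, b}", OF _ _ _ _ _ supp\<nu> supp]) (auto simp: same_integral_def)
qed

section \<open>Half-spaces and marginals\<close>

text \<open>Transporting each \<open>y\<close> to the cheaper of \<open>a\<close> and \<open>b\<close>, where arriving at \<open>b\<close> is rewarded by \<open>t\<close>,
  minimises the cost minus \<open>t\<close> times the mass at \<open>b\<close> over all measures on \<open>{a, b}\<close>.\<close>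

lemma integral_min_le:
  fixes \<mu> \<nu> :: "'a::{real_normed_vector, second_countable_topology} measure"
  assumes \<mu>: "\<mu> \<in> Wasserstein_space p" and \<nu>: "\<nu> \<in> Wasserstein_space p" and "a \<noteq> b"
    and cost: "\<And>\<eta>. \<eta> \<in> Wasserstein_space p \<Longrightarrow> AE z in \<eta>. z \<in> {a, b} \<Longrightarrow>
      transport_cost p \<mu> \<eta> = transport_cost p \<nu> \<eta>"
  shows "(\<integral>y. min (norm (y - a) ^ p) (norm (y - b) ^ p - t) \<partial>\<nu>)
    \<le> (\<integral>y. min (norm (y - a) ^ p) (norm (y - b) ^ p - t) \<partial>\<mu>)"
proof -
  interpret M: prob_space \<mu> by (rule wasserstein_spaceD[OF \<mu>])
  interpret N: prob_space \<nu> by (rule wasserstein_spaceD[OF \<nu>])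
  note [simp] = measurable_wasserstein_space[OF \<mu>] measurable_wasserstein_space[OF \<nu>]
  note int = wasserstein_space_integrable[OF \<mu>] wasserstein_space_integrable[OF \<nu>]
  let ?h = "\<lambda>y. min (norm (y - a) ^ p) (norm (y - b) ^ p - t)"
  have ih: "integrable \<mu> ?h" "integrable \<nu> ?h" using int by auto
  \<comment> \<open>The optimal choice for \<open>\<mu>\<close>, with ties sent to \<open>a\<close>.
    Its image \<open>\<eta>\<close> is used as a test measure for \<open>\<nu>\<close> as well,
    where it need not be optimal; this gives one inequality, and symmetry gives the other.\<close>
  define T where "T y = (if norm (y - b) ^ p - t < norm (y - a) ^ p then b else a)" for y
  have T [measurable]: "T \<in> borel_measurable borel" unfolding T_def by simp
  define \<eta> where "\<eta> = distr \<mu> borel T"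
  have \<eta>: "\<eta> \<in> Wasserstein_space p" unfolding \<eta>_def
  proof (rule distr_in_wasserstein_space[OF \<mu> T])
    show "norm (T y) \<le> 0 * norm y + max (norm a) (norm b)" for y by (auto simp: T_def)
  qed
  interpret H: prob_space \<eta> by (rule wasserstein_spaceD[OF \<eta>])
  have \<eta>ab: "AE z in \<eta>. z \<in> {a, b}"
    unfolding \<eta>_def by (subst AE_distr_iff) (auto simp: T_def)
  let ?i = "\<lambda>z::'a. t * indicator {b} z :: real"
  define l where "l = (\<integral>z. ?i z \<partial>\<eta>)"
  have l: "(\<integral>y. ?i (T y) \<partial>\<mu>) = l" unfolding l_def \<eta>_def by (subst integral_distr) auto
  have iT: "integrable \<mu> (\<lambda>y. ?i (T y))"
    by (rule M.integrable_const_bound[of _ "\<bar>t\<bar>"]) (auto simp: indicator_def)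
  have i\<eta>: "integrable \<eta> ?i"
    by (rule H.integrable_const_bound[of _ "\<bar>t\<bar>"])
      (auto simp: indicator_def measurable_wasserstein_space[OF \<eta>])
  have eqT: "norm (y - T y) ^ p = ?h y + ?i (T y)" for y
    using \<open>a \<noteq> b\<close> by (auto simp: T_def)
  have 1: "transport_cost p \<mu> \<eta> \<le> ennreal ((\<integral>y. ?h y \<partial>\<mu>) + l)"
  proof -
    have "transport_cost p \<mu> \<eta> \<le> (\<integral>\<^sup>+ y. ennreal (norm (y - T y) ^ p) \<partial>\<mu>)"
      unfolding \<eta>_def by (rule transport_cost_map_le[OF \<mu> T])
    also have "\<dots> = ennreal (\<integral>y. norm (y - T y) ^ p \<partial>\<mu>)"
    proof (rule nn_integral_eq_integral)
      show "integrable \<mu> (\<lambda>y. norm (y - T y) ^ p)"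
        unfolding eqT using ih(1) iT by (rule Bochner_Integration.integrable_add)
    qed simp
    also have "(\<integral>y. norm (y - T y) ^ p \<partial>\<mu>) = (\<integral>y. ?h y \<partial>\<mu>) + l"
      unfolding eqT l[symmetric] using ih iT by (intro Bochner_Integration.integral_add)
    finally show ?thesis .
  qed
  have 2: "ennreal ((\<integral>y. ?h y \<partial>\<nu>) + l) \<le> transport_cost p \<nu> \<eta>"
    unfolding transport_cost_def
  proof (rule INF_greatest)
    fix \<pi> assume \<pi>: "\<pi> \<in> couplings \<nu> \<eta>"
    note [measurable] = couplings_measurable[OF \<pi>]
    have hm: "?h \<in> borel_measurable borel" by simp
    have im: "?i \<in> borel_measurable borel" by simp
    note c = integrable_coupling(1,3)[OF \<pi> hm] integrable_coupling(2,4)[OF \<pi> im]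
    have int: "integrable \<pi> (\<lambda>z. ?h (fst z) + ?i (snd z))"
      using c(1)[OF ih(2)] c(3)[OF i\<eta>] by (rule Bochner_Integration.integrable_add)
    \<comment> \<open>Whatever the coupling, arriving at \<open>a\<close> or \<open>b\<close> costs
      at least the minimum plus the reward collected.\<close>
    have ae: "AE z in \<pi>. ?h (fst z) + ?i (snd z) \<le> norm (fst z - snd z) ^ p"
      using AE_coupling(2)[OF \<pi> \<eta>ab] by eventually_elim (use \<open>a \<noteq> b\<close> in auto)
    have "(\<integral>y. ?h y \<partial>\<nu>) + l = (\<integral>z. ?h (fst z) + ?i (snd z) \<partial>\<pi>)"
      unfolding l_def c(2,4)[symmetric] using c(1)[OF ih(2)] c(3)[OF i\<eta>]
      by (rule Bochner_Integration.integral_add[symmetric])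
    \<comment> \<open>The integrand may be negative, so its integral is only bounded by that of its
      positive part.\<close>
    also have "ennreal \<dots> \<le> (\<integral>\<^sup>+ z. ennreal (?h (fst z) + ?i (snd z)) \<partial>\<pi>)"
    proof -
      define I where "I = (\<integral>\<^sup>+ z. ennreal (?h (fst z) + ?i (snd z)) \<partial>\<pi>)"
      have "(\<integral>z. ?h (fst z) + ?i (snd z) \<partial>\<pi>) \<le> enn2real I"
        unfolding I_def by (subst real_lebesgue_integral_def[OF int]) simp
      then have "ennreal (\<integral>z. ?h (fst z) + ?i (snd z) \<partial>\<pi>) \<le> ennreal (enn2real I)" by (rule ennreal_leI)
      also have "ennreal (enn2real I) = I"
        using real_integrable_def[of \<pi> "\<lambda>z. ?h (fst z) + ?i (snd z)"] int
        by (intro ennreal_enn2real) (simp add: less_top I_def)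
      finally show ?thesis unfolding I_def .
    qed
    also have "\<dots> \<le> (\<integral>\<^sup>+ z. ennreal (norm (fst z - snd z) ^ p) \<partial>\<pi>)"
      using ae by (intro nn_integral_mono_AE) (auto elim!: eventually_mono intro: ennreal_leI)
    finally show "ennreal ((\<integral>y. ?h y \<partial>\<nu>) + l) \<le> (\<integral>\<^sup>+ z. ennreal (norm (fst z - snd z) ^ p) \<partial>\<pi>)" .
  qed
  have "ennreal ((\<integral>y. ?h y \<partial>\<nu>) + l) \<le> ennreal ((\<integral>y. ?h y \<partial>\<mu>) + l)"
    using 1 2 cost[OF \<eta> \<eta>ab] by simp
  \<comment> \<open>This is the integral of \<open>norm (y - T y) ^ p\<close>; its sign permits
    passing from \<open>ennreal\<close> back to the reals.\<close>
  moreover have "(\<integral>y. ?h y \<partial>\<mu>) + l \<ge> 0"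
    unfolding l[symmetric] using ih iT
    by (subst Bochner_Integration.integral_add[symmetric]) (auto simp flip: eqT)
  ultimately show ?thesis by (subst (asm) ennreal_le_iff) auto
qed

text \<open>The integrals of the minimum agree for every \<open>t\<close>. Their difference
  quotients at \<open>t = 0\<close> are bounded by \<open>1\<close> and converge to the indicator of
  the set, so dominated convergence applies.\<close>

lemma measure_closer_eq:
  fixes \<mu> \<nu> :: "'a::{real_normed_vector, second_countable_topology} measure"
  assumes \<mu>: "\<mu> \<in> Wasserstein_space p" and \<nu>: "\<nu> \<in> Wasserstein_space p" and "a \<noteq> b" "p > 0"
    and cost: "\<And>\<eta>. \<eta> \<in> Wasserstein_space p \<Longrightarrow> AE z in \<eta>. z \<in> {a, b} \<Longrightarrow>
      transport_cost p \<mu> \<eta> = transport_cost p \<nu> \<eta>"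
  shows "measure \<mu> {y. norm (y - b) < norm (y - a)} = measure \<nu> {y. norm (y - b) < norm (y - a)}"
proof -
  interpret M: prob_space \<mu> by (rule wasserstein_spaceD[OF \<mu>])
  interpret N: prob_space \<nu> by (rule wasserstein_spaceD[OF \<nu>])
  note [simp] = measurable_wasserstein_space[OF \<mu>] measurable_wasserstein_space[OF \<nu>]
    wasserstein_spaceD(1,4)[OF \<mu>] wasserstein_spaceD(1,4)[OF \<nu>]
  note int = wasserstein_space_integrable[OF \<mu>] wasserstein_space_integrable[OF \<nu>]
  let ?h = "\<lambda>t y. min (norm (y - a) ^ p) (norm (y - b) ^ p - t)"
  let ?g = "\<lambda>y. norm (y - b) ^ p - norm (y - a) ^ p"
  let ?A = "{y. norm (y - b) < norm (y - a)}"
  have same: "same_integral \<mu> \<nu> (?h t)" for t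
    unfolding same_integral_def using int
    by (auto intro!: antisym integral_min_le[OF \<mu> \<nu> \<open>a \<noteq> b\<close> cost] integral_min_le[OF \<nu> \<mu> \<open>a \<noteq> b\<close> cost[symmetric]])
  \<comment> \<open>The quotient is taken from negative \<open>t\<close>: points equidistant from
    \<open>a\<close> and \<open>b\<close> then contribute \<open>0\<close>, giving the open
    half-space in the limit.\<close>
  define \<phi> where "\<phi> n y = real (Suc n) * (?h (- 1 / real (Suc n)) y - ?h 0 y)" for n y
  have sphi: "same_integral \<mu> \<nu> (\<phi> n)" for n
    unfolding \<phi>_def by (intro same_integral_cmult same_integral_diff same)
  have \<phi>: "\<phi> n y = (if ?g y \<ge> 0 then 0 else if real (Suc n) * ?g y \<le> - 1 then 1 else - real (Suc n) * ?g y)" for n y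
  proof -
    have m: "min x (z - t) = x + min 0 ((z - x) - t)" for x z t :: real by (auto simp: min_def)
    have "?h (- 1 / real (Suc n)) y - ?h 0 y = min 0 (?g y + 1 / real (Suc n)) - min 0 (?g y)"
      by (subst (1 2) m) (simp add: field_simps)
    then have "\<phi> n y = real (Suc n) * (min 0 (?g y + 1 / real (Suc n)) - min 0 (?g y))"
      unfolding \<phi>_def by simp
    also have "\<dots> = min 0 (real (Suc n) * ?g y + 1) - min 0 (real (Suc n) * ?g y)"
    proof -
      have mm: "real (Suc n) * min 0 x = min 0 (real (Suc n) * x)" for x
        by (auto simp: min_def zero_le_mult_iff mult_le_0_iff)
      have "real (Suc n) * (?g y + 1 / real (Suc n)) = real (Suc n) * ?g y + 1"
        by (simp add: distrib_left)
      then show ?thesis by (simp only: right_diff_distrib mm)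
    qed
    also have "\<dots> = (if ?g y \<ge> 0 then 0 else if real (Suc n) * ?g y \<le> - 1 then 1 else - real (Suc n) * ?g y)"
    proof -
      have "real (Suc n) * ?g y \<ge> 0 \<longleftrightarrow> ?g y \<ge> 0" by (simp add: zero_le_mult_iff del: of_nat_Suc)
      then show ?thesis by (auto simp: min_def simp del: of_nat_Suc)
    qed
    finally show ?thesis .
  qed
  have bnd: "norm (\<phi> n y) \<le> 1" for n y
    unfolding \<phi> by (auto simp del: of_nat_Suc simp: mult_nonneg_nonpos mult_le_0_iff)
  have gA: "?g y < 0 \<longleftrightarrow> y \<in> ?A" for y
    using \<open>p > 0\<close> power_strict_mono[of "norm (y - b)" "norm (y - a)" p]
      power_mono[of "norm (y - a)" "norm (y - b)" p] by fastforce
  have lim: "(\<lambda>n. \<phi> n y) \<longlonglongrightarrow> indicator ?A y" for y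
  proof (cases "?g y < 0")
    case False
    then show ?thesis using gA[of y] by (simp add: \<phi>)
  next
    case True
    then obtain m where m: "1 < real m * (- ?g y)" using ex_less_of_nat_mult[of "- ?g y" 1] by auto
    have "\<phi> n y = 1" if "n \<ge> m" for n
    proof -
      have "real m * (- ?g y) \<le> real (Suc n) * (- ?g y)"
        using that True by (intro mult_right_mono) auto
      then have "real (Suc n) * ?g y \<le> - 1" using m by linarith
      then show ?thesis unfolding \<phi> using True by (simp del: of_nat_Suc)
    qed
    then have "eventually (\<lambda>n. \<phi> n y = indicator ?A y) sequentially"
      using gA[of y] True by (auto intro!: eventually_sequentiallyI[of m])
    then show ?thesis by (rule tendsto_eventually)
  qed
  have A [measurable]: "?A \<in> sets borel" by simp
  have \<phi>m: "\<phi> n \<in> borel_measurable borel" for n unfolding \<phi>_def by simp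
  have "(\<lambda>n. \<integral>y. \<phi> n y \<partial>\<mu>) \<longlonglongrightarrow> (\<integral>y. indicator ?A y \<partial>\<mu>)"
    by (rule integral_dominated_convergence[where w = "\<lambda>_. 1"]) (use lim bnd \<phi>m in auto)
  moreover have "(\<lambda>n. \<integral>y. \<phi> n y \<partial>\<nu>) \<longlonglongrightarrow> (\<integral>y. indicator ?A y \<partial>\<nu>)"
    by (rule integral_dominated_convergence[where w = "\<lambda>_. 1"]) (use lim bnd \<phi>m in auto)
  moreover have "(\<integral>y. \<phi> n y \<partial>\<mu>) = (\<integral>y. \<phi> n y \<partial>\<nu>)" for n
    using sphi by (simp add: same_integral_def)
  ultimately have "(\<integral>y. indicator ?A y \<partial>\<mu>) = (\<integral>y. indicator ?A y \<partial>\<nu> :: real)"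
    by (simp only:) (rule LIMSEQ_unique)
  then show ?thesis by simp
qed

text \<open>In an inner product space an open half-space consists of the points closer to one point
  than to another, so half-space masses agree. These are the complements of the distribution
  functions of the marginals.\<close>

lemma distr_inner_eq:
  fixes \<mu> \<nu> :: "'a::{real_inner, second_countable_topology} measure"
  assumes \<mu>: "\<mu> \<in> Wasserstein_space p" and \<nu>: "\<nu> \<in> Wasserstein_space p" and "p > 0"
    and cost: "\<And>\<eta> a b. \<eta> \<in> Wasserstein_space p \<Longrightarrow> a \<noteq> b \<Longrightarrow> AE z in \<eta>. z \<in> {a, b} \<Longrightarrow>
      transport_cost p \<mu> \<eta> = transport_cost p \<nu> \<eta>"
  shows "distr \<mu> borel (\<lambda>y. u \<bullet> y) = distr \<nu> borel (\<lambda>y. u \<bullet> y)"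
proof -
  interpret M: prob_space \<mu> by (rule wasserstein_spaceD[OF \<mu>])
  interpret N: prob_space \<nu> by (rule wasserstein_spaceD[OF \<nu>])
  note [simp] = measurable_wasserstein_space[OF \<mu>] measurable_wasserstein_space[OF \<nu>]
    wasserstein_spaceD(1,4)[OF \<mu>] wasserstein_spaceD(1,4)[OF \<nu>]
  have um [measurable]: "(\<lambda>y. u \<bullet> y) \<in> borel_measurable borel"
    by (intro borel_measurable_continuous_onI continuous_intros)
  have half: "measure \<mu> {y. s < u \<bullet> y} = measure \<nu> {y. s < u \<bullet> y}" for s
  proof (cases "u = 0")
    case True
    then show ?thesis using M.prob_space N.prob_space by (cases "s < 0") auto
  next
    case False
    \<comment> \<open>Chosen so that the midpoint of \<open>a\<close> and \<open>a + u\<close> lies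
      on the hyperplane where the inner product with \<open>u\<close> equals \<open>s\<close>; that
      hyperplane is then their bisector.\<close>
    define a where "a = (s / (u \<bullet> u) - 1 / 2) *\<^sub>R u"
    have "norm (y - (a + u)) < norm (y - a) \<longleftrightarrow> s < u \<bullet> y" for y
    proof -
      have "norm (y - (a + u)) < norm (y - a) \<longleftrightarrow> (y - (a + u)) \<bullet> (y - (a + u)) < (y - a) \<bullet> (y - a)"
        by (simp add: norm_lt)
      also have "\<dots> \<longleftrightarrow> 2 * (u \<bullet> a) + u \<bullet> u < 2 * (u \<bullet> y)"
        by (simp add: algebra_simps inner_commute)
      also have "2 * (u \<bullet> a) + u \<bullet> u = 2 * s"
        using False by (simp add: a_def field_simps)
      finally show ?thesis by simp
    qed
    then show ?thesis
      using measure_closer_eq[OF \<mu> \<nu> _ \<open>p > 0\<close> cost[where a = a and b = "a + u"], of a "a + u"] False by simp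
  qed
  show ?thesis
  proof (rule cdf_unique)
    show "real_distribution (distr \<mu> borel (\<lambda>y. u \<bullet> y))" "real_distribution (distr \<nu> borel (\<lambda>y. u \<bullet> y))"
      using M.prob_space_distr[of "\<lambda>y. u \<bullet> y" borel] N.prob_space_distr[of "\<lambda>y. u \<bullet> y" borel]
      by (auto simp: real_distribution_def real_distribution_axioms_def)
    show "cdf (distr \<mu> borel (\<lambda>y. u \<bullet> y)) = cdf (distr \<nu> borel (\<lambda>y. u \<bullet> y))"
    proof
      fix s
      have eq: "(\<lambda>y. u \<bullet> y) -` {..s} = UNIV - {y. s < u \<bullet> y}" by auto
      have hs: "{y. s < u \<bullet> y} \<in> sets borel" by simp
      show "cdf (distr \<mu> borel (\<lambda>y. u \<bullet> y)) s = cdf (distr \<nu> borel (\<lambda>y. u \<bullet> y)) s"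
        using M.prob_compl[of "{y. s < u \<bullet> y}"] N.prob_compl[of "{y. s < u \<bullet> y}"] hs half[of s]
        by (simp add: cdf_def measure_distr eq)
    qed
  qed
qed

section \<open>Finitely supported measures\<close>

text \<open>Finitely many hyperplanes do not cover the space: moving \<open>u\<close> along the new
  vector \<open>v\<close> avoids all of them except for finitely many parameters.\<close>

lemma exists_inner_nonzero:
  fixes V :: "'a::real_inner set"
  assumes "finite V" "0 \<notin> V"
  shows "\<exists>u. \<forall>v\<in>V. u \<bullet> v \<noteq> 0"
  using assms
proof (induction V)
  case (insert v V)
  then obtain u where u: "\<forall>v\<in>V. u \<bullet> v \<noteq> 0" by auto
  \<comment> \<open>Contains every parameter at which the inner product with \<open>v\<close> or a
    vector of \<open>V\<close> not orthogonal to \<open>v\<close> vanishes.\<close>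
  define B where "B = insert 0 (insert (- (u \<bullet> v) / (v \<bullet> v)) ((\<lambda>w. - (u \<bullet> w) / (v \<bullet> w)) ` V))"
  have "finite B" using insert by (simp add: B_def)
  then obtain s :: real where s: "s \<notin> B" using ex_new_if_finite infinite_UNIV_char_0 by blast
  have "(u + s *\<^sub>R v) \<bullet> w \<noteq> 0" if "w \<in> insert v V" for w
  proof (cases "v \<bullet> w = 0")
    case True
    with that insert.prems u show ?thesis by (auto simp: inner_add_left)
  next
    case False
    have "s \<noteq> - (u \<bullet> w) / (v \<bullet> w)" using s that by (auto simp: B_def)
    with False show ?thesis by (auto simp: inner_add_left field_simps add_eq_0_iff)
  qed
  then show ?case by blast
qed simp

text \<open>Marginals in a countable dense set of directions force \<open>\<nu>\<close> onto
  \<open>S\<close>; a single direction separating the points of \<open>S\<close> then reads off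
  their masses.\<close>

lemma measure_eqI_inner_finite_support:
  fixes \<mu> \<nu> :: "'a::{real_inner, second_countable_topology} measure"
  assumes \<mu>: "\<mu> \<in> Wasserstein_space p" and \<nu>: "\<nu> \<in> Wasserstein_space p"
    and eq: "\<And>u. distr \<mu> borel (\<lambda>y. u \<bullet> y) = distr \<nu> borel (\<lambda>y. u \<bullet> y)"
    and S: "finite S" "AE y in \<mu>. y \<in> S"
  shows "\<nu> = \<mu>"
proof -
  interpret M: prob_space \<mu> by (rule wasserstein_spaceD[OF \<mu>])
  interpret N: prob_space \<nu> by (rule wasserstein_spaceD[OF \<nu>])
  note [simp] = measurable_wasserstein_space[OF \<mu>] measurable_wasserstein_space[OF \<nu>]
    wasserstein_spaceD(1,4)[OF \<mu>] wasserstein_spaceD(1,4)[OF \<nu>]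
  have um [measurable]: "(\<lambda>y. u \<bullet> y) \<in> borel_measurable borel" for u :: 'a
    by (intro borel_measurable_continuous_onI continuous_intros)
  have ae: "AE y in \<nu>. \<exists>x\<in>S. u \<bullet> (y - x) = 0" for u
  proof -
    let ?F = "(\<lambda>x. u \<bullet> x) ` S"
    have F: "?F \<in> sets borel" using S(1) by (intro borel_closed finite_imp_closed) auto
    have "AE y in \<mu>. u \<bullet> y \<in> ?F" using S(2) by eventually_elim auto
    then have "AE t in distr \<mu> borel (\<lambda>y. u \<bullet> y). t \<in> ?F" using F by (subst AE_distr_iff) auto
    then have "AE y in \<nu>. u \<bullet> y \<in> ?F" unfolding eq using F by (subst (asm) AE_distr_iff) auto
    then show ?thesis by eventually_elim (auto simp: inner_diff_right)
  qed
  \<comment> \<open>Countability allows one null set to serve all directions in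
    \<open>D\<close>.\<close>
  obtain D :: "'a set" where D: "countable D" "\<And>X. open X \<Longrightarrow> X \<noteq> {} \<Longrightarrow> \<exists>d\<in>D. d \<in> X"
    by (erule countable_dense_setE)
  have "AE y in \<nu>. \<forall>u\<in>D. \<exists>x\<in>S. u \<bullet> (y - x) = 0"
    using D(1) ae by (simp add: AE_ball_countable)
  then have supp: "AE y in \<nu>. y \<in> S"
  proof eventually_elim
    fix y assume y: "\<forall>u\<in>D. \<exists>x\<in>S. u \<bullet> (y - x) = 0"
    show "y \<in> S"
    proof (rule ccontr)
      assume "y \<notin> S"
      then obtain u where u: "\<forall>v\<in>(\<lambda>x. y - x) ` S. u \<bullet> v \<noteq> 0"
        using exists_inner_nonzero[of "(\<lambda>x. y - x) ` S"] S(1) by force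
      let ?X = "\<Inter>x\<in>S. {u. u \<bullet> (y - x) \<noteq> 0}"
      \<comment> \<open>The directions separating \<open>y\<close> from all of \<open>S\<close> form
        a nonempty open set, which must meet \<open>D\<close>.\<close>
      have "open ?X"
        using S(1) by (intro open_INT ballI open_Collect_neq continuous_intros) auto
      with D(2)[of ?X] u y show False by auto
    qed
  qed
  obtain u where u: "\<forall>v\<in>(\<lambda>(x, y). x - y) ` (S \<times> S) - {0}. u \<bullet> v \<noteq> 0"
    using exists_inner_nonzero[of "(\<lambda>(x, y). x - y) ` (S \<times> S) - {0}"] S(1) by blast
  have mass: "measure \<rho> {x} = measure (distr \<rho> borel (\<lambda>y. u \<bullet> y)) {u \<bullet> x}"
    if \<rho>: "\<rho> \<in> Wasserstein_space p" "AE y in \<rho>. y \<in> S" and x: "x \<in> S" for \<rho> x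
  proof -
    interpret R: prob_space \<rho> by (rule wasserstein_spaceD[OF \<rho>(1)])
    note [simp] = measurable_wasserstein_space[OF \<rho>(1)] wasserstein_spaceD(1,4)[OF \<rho>(1)]
    have m: "(\<lambda>y. u \<bullet> y) -` {u \<bullet> x} \<in> sets borel" using measurable_sets_borel[OF um[of u], of "{u \<bullet> x}"] by simp
    have "measure \<rho> {x} = measure \<rho> ((\<lambda>y. u \<bullet> y) -` {u \<bullet> x})"
    proof (rule R.finite_measure_eq_AE)
      show "AE y in \<rho>. (y \<in> {x}) = (y \<in> (\<lambda>y. u \<bullet> y) -` {u \<bullet> x})"
        using \<rho>(2)
      proof eventually_elim
        fix y assume "y \<in> S"
        then have "y - x \<in> (\<lambda>(x, y). x - y) ` (S \<times> S)" using x by force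
        then have "y \<noteq> x \<Longrightarrow> u \<bullet> (y - x) \<noteq> 0" using u by simp
        then show "(y \<in> {x}) = (y \<in> (\<lambda>y. u \<bullet> y) -` {u \<bullet> x})" by (auto simp: inner_diff_right)
      qed
    qed (use m in simp_all)
    then show ?thesis by (simp add: measure_distr)
  qed
  show ?thesis
    by (rule measure_eqI_finite_support[OF _ _ _ _ S(1) supp S(2)])
      (simp_all add: mass[OF \<mu> S(2)] mass[OF \<nu> supp] eq M.prob_space_axioms N.prob_space_axioms)
qed

text \<open>The identity is a pointwise limit of simple functions of norm at most
  \<open>2 * norm x\<close>. Their push-forwards have finite support, and dominated convergence
  sends the cost of the corresponding maps to \<open>0\<close>.\<close>

lemma finite_support_dense:
  fixes \<mu> :: "'a::{real_normed_vector, second_countable_topology} measure"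
  assumes \<mu>: "\<mu> \<in> Wasserstein_space p" and "\<epsilon> > 0" and "p > 0"
  obtains \<sigma> S where "\<sigma> \<in> Wasserstein_space p" "finite S" "AE y in \<sigma>. y \<in> S" "transport_cost p \<mu> \<sigma> < \<epsilon>"
proof -
  note [simp] = measurable_wasserstein_space[OF \<mu>] wasserstein_spaceD(1,4)[OF \<mu>]
  have "\<exists>F. (\<forall>i. simple_function \<mu> (F i)) \<and> (\<forall>x\<in>space \<mu>. (\<lambda>i. F i x) \<longlonglongrightarrow> x) \<and>
      (\<forall>i. \<forall>x\<in>space \<mu>. dist (F i x) 0 \<le> 2 * dist x 0)"
    by (rule borel_measurable_implies_sequence_metric) simp
  then obtain F :: "nat \<Rightarrow> 'a \<Rightarrow> 'a" where F: "\<And>i. simple_function \<mu> (F i)"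
    and lim: "\<And>x. (\<lambda>i. F i x) \<longlonglongrightarrow> x" and bnd: "\<And>i x. norm (F i x) \<le> 2 * norm x" by auto
  have Fm [measurable]: "F i \<in> borel_measurable borel" for i
    using borel_measurable_simple_function[OF F[of i]] by simp
  have W: "distr \<mu> borel (F i) \<in> Wasserstein_space p" for i
    by (rule distr_in_wasserstein_space[OF \<mu> Fm, of _ 2 0]) (simp add: bnd)
  have "(\<lambda>i. \<integral>\<^sup>+ x. ennreal (norm (x - F i x) ^ p) \<partial>\<mu>) \<longlonglongrightarrow> (\<integral>\<^sup>+ x. 0 \<partial>\<mu>)"
  proof (rule nn_integral_dominated_convergence[where w = "\<lambda>x. ennreal (3 ^ p * norm (x - 0) ^ p)"])
    show "(\<integral>\<^sup>+ x. ennreal (3 ^ p * norm (x - 0) ^ p) \<partial>\<mu>) < \<infinity>"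
      using wasserstein_space_integrable[OF \<mu>, of 0]
      by (subst nn_integral_eq_integral) auto
    show "AE x in \<mu>. ennreal (norm (x - F i x) ^ p) \<le> ennreal (3 ^ p * norm (x - 0) ^ p)" for i
    proof (rule AE_I2, rule ennreal_leI)
      fix x
      have "norm (x - F i x) \<le> 3 * norm x" using norm_triangle_ineq4[of x "F i x"] bnd[of i x] by simp
      then have "norm (x - F i x) ^ p \<le> (3 * norm x) ^ p" by (intro power_mono) auto
      then show "norm (x - F i x) ^ p \<le> 3 ^ p * norm (x - 0) ^ p" by (simp add: power_mult_distrib)
    qed
    show "AE x in \<mu>. (\<lambda>i. ennreal (norm (x - F i x) ^ p)) \<longlonglongrightarrow> 0"
    proof (rule AE_I2)
      fix x
      have "(\<lambda>i. ennreal (norm (x - F i x) ^ p)) \<longlonglongrightarrow> ennreal (norm (x - x) ^ p)"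
        by (intro tendsto_ennrealI tendsto_power tendsto_norm tendsto_diff tendsto_const lim)
      then show "(\<lambda>i. ennreal (norm (x - F i x) ^ p)) \<longlonglongrightarrow> 0" using \<open>p > 0\<close>
        by (simp only: diff_self norm_zero zero_power ennreal_0)
    qed
  qed simp_all
  then have "eventually (\<lambda>i. (\<integral>\<^sup>+ x. ennreal (norm (x - F i x) ^ p) \<partial>\<mu>) < \<epsilon>) sequentially"
    using order_tendstoD(2)[of _ 0 sequentially \<epsilon>] \<open>\<epsilon> > 0\<close> by simp
  then obtain i where i: "(\<integral>\<^sup>+ x. ennreal (norm (x - F i x) ^ p) \<partial>\<mu>) < \<epsilon>"
    using eventually_happens'[OF sequentially_bot] by blast
  have fin: "finite (range (F i))" using F[of i] by (simp add: simple_function_def)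
  have "AE y in distr \<mu> borel (F i). y \<in> range (F i)"
    using fin by (subst AE_distr_iff) (auto intro!: borel_closed finite_imp_closed)
  with that[OF W fin] show ?thesis
    using i transport_cost_map_le[OF \<mu> Fm, of p i] by (meson le_less_trans)
qed

text \<open>The elementary bound \<open>d \<le> \<delta> + \<delta> / \<delta> ^ p * d ^ p\<close>
  takes the place of Hoelder's inequality, at the price of the factor 2.\<close>

lemma integral_diff_le_transport_cost:
  fixes \<mu> \<sigma> :: "'a::{real_normed_vector, second_countable_topology} measure" and f :: "'a \<Rightarrow> real"
  assumes \<mu>: "\<mu> \<in> Wasserstein_space p" and \<sigma>: "\<sigma> \<in> Wasserstein_space p" and "p > 0"
    and f: "\<And>x. \<bar>f x\<bar> \<le> 1" and lip: "\<And>x y. \<bar>f x - f y\<bar> \<le> L * norm (x - y)" and "L > 0"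
    and "\<delta> > 0" and cost: "transport_cost p \<mu> \<sigma> < ennreal (\<delta> ^ p)"
  shows "\<bar>(\<integral>x. f x \<partial>\<mu>) - (\<integral>x. f x \<partial>\<sigma>)\<bar> \<le> 2 * L * \<delta>"
proof -
  obtain \<pi> where \<pi>: "\<pi> \<in> couplings \<mu> \<sigma>" and c: "(\<integral>\<^sup>+ z. ennreal (norm (fst z - snd z) ^ p) \<partial>\<pi>) < ennreal (\<delta> ^ p)"
    using cost unfolding transport_cost_def INF_less_iff by blast
  note [measurable] = couplings_measurable[OF \<pi>]
  interpret P: prob_space \<pi> by (rule couplingsD[OF \<pi>])
  interpret M: prob_space \<mu> by (rule wasserstein_spaceD[OF \<mu>])
  interpret S: prob_space \<sigma> by (rule wasserstein_spaceD[OF \<sigma>])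
  have "L-lipschitz_on UNIV f" using lip \<open>L > 0\<close> by (auto simp: lipschitz_on_def dist_norm)
  then have fm [measurable]: "f \<in> borel_measurable borel"
    by (intro borel_measurable_continuous_onI lipschitz_on_continuous_on)
  have i: "integrable \<mu> f" "integrable \<sigma> f"
    using f by (auto intro!: M.integrable_const_bound[of _ 1] S.integrable_const_bound[of _ 1]
        simp: measurable_wasserstein_space[OF \<mu>] measurable_wasserstein_space[OF \<sigma>])
  have ip: "integrable \<pi> (\<lambda>z. norm (fst z - snd z) ^ p)"
  proof (rule integrableI_nonneg)
    show "(\<integral>\<^sup>+ z. ennreal (norm (fst z - snd z) ^ p) \<partial>\<pi>) < \<infinity>" using c by (rule less_trans) simp
  qed auto
  have "ennreal (\<integral>z. norm (fst z - snd z) ^ p \<partial>\<pi>) < ennreal (\<delta> ^ p)"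
    using c by (subst (asm) nn_integral_eq_integral[OF ip]) auto
  then have cr: "(\<integral>z. norm (fst z - snd z) ^ p \<partial>\<pi>) \<le> \<delta> ^ p"
    using \<open>\<delta> > 0\<close> by (simp add: ennreal_less_iff)
  note fi = integrable_coupling(1)[OF \<pi> fm i(1)] integrable_coupling(2)[OF \<pi> fm i(2)]
  have pw: "\<bar>f (fst z) - f (snd z)\<bar> \<le> L * \<delta> + L * \<delta> / \<delta> ^ p * norm (fst z - snd z) ^ p" for z
  proof -
    have "d \<le> \<delta> + \<delta> / \<delta> ^ p * d ^ p" if "d \<ge> 0" for d :: real
    proof (cases "d \<le> \<delta>")
      case True
      then show ?thesis using that \<open>\<delta> > 0\<close> by (simp add: add_increasing2)
    next
      case False
      obtain m where m: "p = Suc m" using \<open>p > 0\<close> gr0_implies_Suc by blast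
      have "\<delta> ^ m * d \<le> d ^ m * d" using False \<open>\<delta> > 0\<close> by (intro mult_right_mono power_mono) auto
      then have "d \<le> \<delta> / \<delta> ^ p * d ^ p" using \<open>\<delta> > 0\<close> by (simp add: m field_simps)
      then show ?thesis using \<open>\<delta> > 0\<close> by simp
    qed
    from mult_left_mono[OF this[of "norm (fst z - snd z)"], of L] \<open>L > 0\<close>
    show ?thesis using lip[of "fst z" "snd z"] by (simp add: algebra_simps)
  qed
  have "\<bar>(\<integral>x. f x \<partial>\<mu>) - (\<integral>x. f x \<partial>\<sigma>)\<bar> = \<bar>\<integral>z. f (fst z) - f (snd z) \<partial>\<pi>\<bar>"
    using fi by (simp add: integrable_coupling(3,4)[OF \<pi> fm])
  also have "\<dots> \<le> (\<integral>z. \<bar>f (fst z) - f (snd z)\<bar> \<partial>\<pi>)" by (rule integral_abs_bound)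
  also have "\<dots> \<le> (\<integral>z. L * \<delta> + L * \<delta> / \<delta> ^ p * norm (fst z - snd z) ^ p \<partial>\<pi>)"
    using fi ip pw by (intro integral_mono) auto
  also have "\<dots> = L * \<delta> + L * \<delta> / \<delta> ^ p * (\<integral>z. norm (fst z - snd z) ^ p \<partial>\<pi>)"
    using ip P.prob_space by simp
  also have "\<dots> \<le> L * \<delta> + L * \<delta> / \<delta> ^ p * \<delta> ^ p"
    using cr \<open>L > 0\<close> \<open>\<delta> > 0\<close> by (intro add_left_mono mult_left_mono) auto
  also have "\<dots> = 2 * L * \<delta>" using \<open>\<delta> > 0\<close> by simp
  finally show ?thesis .
qed

text \<open>Common approximants \<open>\<sigma>\<close> replace a triangle inequality for the cost.
  They give equal integrals of bounded Lipschitz functions, which approximate indicators of closed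
  sets.\<close>

lemma measure_eqI_transport_cost:
  fixes \<mu> \<nu> :: "'a::{real_normed_vector, second_countable_topology} measure"
  assumes \<mu>: "\<mu> \<in> Wasserstein_space p" and \<nu>: "\<nu> \<in> Wasserstein_space p" and "p > 0"
    and cost: "\<And>\<epsilon>. \<epsilon> > 0 \<Longrightarrow> \<exists>\<sigma>\<in>Wasserstein_space p. transport_cost p \<mu> \<sigma> < \<epsilon> \<and> transport_cost p \<nu> \<sigma> < \<epsilon>"
  shows "\<mu> = \<nu>"
proof -
  interpret M: prob_space \<mu> by (rule wasserstein_spaceD[OF \<mu>])
  interpret N: prob_space \<nu> by (rule wasserstein_spaceD[OF \<nu>])
  note [simp] = measurable_wasserstein_space[OF \<mu>] measurable_wasserstein_space[OF \<nu>]
    wasserstein_spaceD(1,4)[OF \<mu>] wasserstein_spaceD(1,4)[OF \<nu>]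
  have lip: "(\<integral>x. f x \<partial>\<mu>) = (\<integral>x. f x \<partial>\<nu>)"
    if f: "\<And>x. \<bar>f x\<bar> \<le> 1" and lip: "\<And>x y. \<bar>f x - f y\<bar> \<le> L * norm (x - y)" and L: "L > 0"
    for f :: "'a \<Rightarrow> real" and L
  proof -
    have "\<bar>(\<integral>x. f x \<partial>\<mu>) - (\<integral>x. f x \<partial>\<nu>)\<bar> \<le> 0 + e" if "e > 0" for e
    proof -
      \<comment> \<open>Each of the two comparisons with \<open>\<sigma>\<close> then contributes at
        most \<open>e / 2\<close>.\<close>
      define \<delta> where "\<delta> = e / (4 * L)"
      have \<delta>: "\<delta> > 0" using that L by (simp add: \<delta>_def)
      then obtain \<sigma> where \<sigma>: "\<sigma> \<in> Wasserstein_space p" "transport_cost p \<mu> \<sigma> < ennreal (\<delta> ^ p)" "transport_cost p \<nu> \<sigma> < ennreal (\<delta> ^ p)"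
        using cost[of "ennreal (\<delta> ^ p)"] by auto
      have "2 * L * \<delta> = e / 2" using L by (simp add: \<delta>_def)
      with integral_diff_le_transport_cost[OF \<mu> \<sigma>(1) \<open>p > 0\<close> f lip L \<delta> \<sigma>(2)]
        integral_diff_le_transport_cost[OF \<nu> \<sigma>(1) \<open>p > 0\<close> f lip L \<delta> \<sigma>(3)]
      show ?thesis by linarith
    qed
    then have "\<bar>(\<integral>x. f x \<partial>\<mu>) - (\<integral>x. f x \<partial>\<nu>)\<bar> \<le> 0" by (rule field_le_epsilon)
    then show ?thesis by simp
  qed
  have closed_eq: "emeasure \<mu> A = emeasure \<nu> A" if "closed A" for A
  proof (cases "A = {}")
    case False
    \<comment> \<open>Lipschitz functions decreasing to the indicator of \<open>A\<close>. The empty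
      set is treated separately because \<open>infdist x {}\<close> is \<open>0\<close>.\<close>
    define f where "f n x = max 0 (1 - real (Suc n) * infdist x A)" for n x
    have fl: "\<bar>f n x - f n y\<bar> \<le> real (Suc n) * norm (x - y)" for n x y
    proof -
      have "\<bar>f n x - f n y\<bar> \<le> \<bar>real (Suc n) * infdist x A - real (Suc n) * infdist y A\<bar>"
        unfolding f_def by linarith
      also have "\<dots> = real (Suc n) * \<bar>infdist x A - infdist y A\<bar>"
        by (simp add: abs_mult del: of_nat_Suc flip: right_diff_distrib)
      also have "\<dots> \<le> real (Suc n) * norm (x - y)"
        using infdist_triangle_abs[of x A y] by (intro mult_left_mono) (auto simp: dist_norm)
      finally show ?thesis .
    qed
    have fb: "\<bar>f n x\<bar> \<le> 1" for n x
      unfolding f_def using infdist_nonneg[of x A] mult_nonneg_nonneg[of "real (Suc n)" "infdist x A"] by simp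
    have lim: "(\<lambda>n. f n x) \<longlonglongrightarrow> indicator A x" for x
    proof (cases "x \<in> A")
      case True
      then show ?thesis by (simp add: f_def)
    next
      case xA: False
      then have "infdist x A > 0"
        using in_closed_iff_infdist_zero[OF \<open>closed A\<close> False, of x] infdist_nonneg[of x A] by (simp add: less_le)
      then obtain m where m: "1 < real m * infdist x A" using ex_less_of_nat_mult[of "infdist x A" 1] by auto
      have "f n x = 0" if "n \<ge> m" for n
      proof -
        have "real m * infdist x A \<le> real (Suc n) * infdist x A"
          using that infdist_nonneg by (intro mult_right_mono) auto
        with m show ?thesis by (simp add: f_def)
      qed
      then have "eventually (\<lambda>n. f n x = indicator A x) sequentially"
        using xA by (auto intro!: eventually_sequentiallyI[of m])
      then show ?thesis by (rule tendsto_eventually)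
    qed
    have fm: "f n \<in> borel_measurable borel" for n
      unfolding f_def by (intro borel_measurable_continuous_onI continuous_intros)
    have A: "A \<in> sets borel" using \<open>closed A\<close> by (rule borel_closed)
    have "(\<lambda>n. \<integral>y. f n y \<partial>\<mu>) \<longlonglongrightarrow> (\<integral>y. indicator A y \<partial>\<mu>)"
      by (rule integral_dominated_convergence[where w = "\<lambda>_. 1"]) (use lim fb fm A in auto)
    moreover have "(\<lambda>n. \<integral>y. f n y \<partial>\<nu>) \<longlonglongrightarrow> (\<integral>y. indicator A y \<partial>\<nu>)"
      by (rule integral_dominated_convergence[where w = "\<lambda>_. 1"]) (use lim fb fm A in auto)
    moreover have "(\<integral>y. f n y \<partial>\<mu>) = (\<integral>y. f n y \<partial>\<nu>)" for n
      using fl fb by (intro lip[of _ "real (Suc n)"]) auto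
    ultimately have "(\<integral>y. indicator A y \<partial>\<mu>) = (\<integral>y. indicator A y \<partial>\<nu> :: real)"
      by (simp only:) (rule LIMSEQ_unique)
    then show ?thesis by (simp add: M.emeasure_eq_measure N.emeasure_eq_measure)
  qed simp
  show ?thesis
  proof (rule measure_eqI_generator_eq[where E = "Collect closed" and \<Omega> = UNIV and A = "\<lambda>_. UNIV"])
    show "Int_stable (Collect closed :: 'a set set)" by (auto simp: Int_stable_def)
    show "sets \<mu> = sigma_sets UNIV (Collect closed)" "sets \<nu> = sigma_sets UNIV (Collect closed)"
      by (simp_all add: borel_eq_closed)
  qed (use closed_eq in auto)
qed

text \<open>Each class of fixed measures tests the next: Dirac measures give the potentials and so
  fix two-point measures, which give the marginals and so fix finitely supported measures, which are
  dense.\<close>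

lemma isometry_fixing_Diracs_eq_id:
  fixes \<Psi> :: "'a::{real_inner, second_countable_topology} measure \<Rightarrow> 'a measure"
  assumes "even p" "p \<ge> 4"
    and W: "\<And>\<mu>. \<mu> \<in> Wasserstein_space p \<Longrightarrow> \<Psi> \<mu> \<in> Wasserstein_space p"
    and cost: "\<And>\<mu> \<nu>. \<mu> \<in> Wasserstein_space p \<Longrightarrow> \<nu> \<in> Wasserstein_space p \<Longrightarrow>
      transport_cost p (\<Psi> \<mu>) (\<Psi> \<nu>) = transport_cost p \<mu> \<nu>"
    and fix_Dirac: "\<And>x. \<Psi> (return borel x) = return borel x"
    and \<mu>: "\<mu> \<in> Wasserstein_space p"
  shows "\<Psi> \<mu> = \<mu>"
proof -
  have p: "p > 0" using \<open>p \<ge> 4\<close> by simp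
  have pot: "(\<integral>y. norm (y - x) ^ p \<partial>\<mu>) = (\<integral>y. norm (y - x) ^ p \<partial>\<Psi> \<mu>)" if \<mu>: "\<mu> \<in> Wasserstein_space p" for \<mu> x
  proof -
    have "ennreal (\<integral>y. norm (y - x) ^ p \<partial>\<mu>) = ennreal (\<integral>y. norm (y - x) ^ p \<partial>\<Psi> \<mu>)"
      using cost[OF return_in_wasserstein_space[of x] \<mu>]
      by (simp add: fix_Dirac transport_cost_return_left wasserstein_space_nn_integral W \<mu>)
    then show ?thesis by (subst (asm) ennreal_inj) auto
  qed
  have fix2: "\<Psi> \<eta> = \<eta>" if "\<eta> \<in> Wasserstein_space p" "a \<noteq> b" "AE z in \<eta>. z \<in> {a, b}" for \<eta> a b
    using two_point_measure_determined[OF \<open>even p\<close> \<open>p \<ge> 4\<close> that(1) W[OF that(1)] pot[OF that(1)] that(2,3)] .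
  have fix_fin: "\<Psi> \<sigma> = \<sigma>" if \<sigma>: "\<sigma> \<in> Wasserstein_space p" and S: "finite S" "AE y in \<sigma>. y \<in> S" for \<sigma> S
  proof (rule measure_eqI_inner_finite_support[OF \<sigma> W[OF \<sigma>] _ S])
    show "distr \<sigma> borel (\<lambda>y. u \<bullet> y) = distr (\<Psi> \<sigma>) borel (\<lambda>y. u \<bullet> y)" for u
    proof (rule distr_inner_eq[OF \<sigma> W[OF \<sigma>] p])
      show "transport_cost p \<sigma> \<eta> = transport_cost p (\<Psi> \<sigma>) \<eta>"
        if "\<eta> \<in> Wasserstein_space p" "a \<noteq> b" "AE z in \<eta>. z \<in> {a, b}" for \<eta> a b
        using cost[OF \<sigma> that(1)] fix2[OF that] by simp
    qed
  qed
  show ?thesis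
  proof (rule measure_eqI_transport_cost[OF W[OF \<mu>] \<mu> p])
    fix \<epsilon> :: ennreal assume "\<epsilon> > 0"
    obtain \<sigma> S where \<sigma>: "\<sigma> \<in> Wasserstein_space p" "finite S" "AE y in \<sigma>. y \<in> S" "transport_cost p \<mu> \<sigma> < \<epsilon>"
      using finite_support_dense[OF \<mu> \<open>\<epsilon> > 0\<close> p] by blast
    \<comment> \<open>As \<open>\<Psi>\<close> fixes \<open>\<sigma>\<close>, its cost to
      \<open>\<Psi> \<mu>\<close> equals its cost to \<open>\<mu>\<close>.\<close>
    then show "\<exists>\<sigma>\<in>Wasserstein_space p. transport_cost p (\<Psi> \<mu>) \<sigma> < \<epsilon> \<and> transport_cost p \<mu> \<sigma> < \<epsilon>"
      using cost[OF \<mu> \<sigma>(1)] fix_fin[OF \<sigma>(1-3)] by (intro bexI[of _ \<sigma>]) simp_all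
  qed
qed

section \<open>Reduction to an isometry fixing every Dirac measure\<close>

theorem theorem3p18:
  fixes \<Phi> :: "('a::{real_inner, complete_space, second_countable_topology}) measure \<Rightarrow> 'a measure"
    and p :: nat
  assumes "even p" and "p \<ge> 4"
    and "bij_betw \<Phi> (Wasserstein_space p) (Wasserstein_space p)"
    and "\<forall>\<mu>\<in>Wasserstein_space p. \<forall>\<nu>\<in>Wasserstein_space p.
           wasserstein_dist p (\<Phi> \<mu>) (\<Phi> \<nu>) = wasserstein_dist p \<mu> \<nu>"
  shows "\<exists>\<psi> :: 'a \<Rightarrow> 'a. bij \<psi> \<and> (\<forall>x y. dist (\<psi> x) (\<psi> y) = dist x y) \<and>
           (\<forall>\<mu>\<in>Wasserstein_space p. \<Phi> \<mu> = distr \<mu> borel \<psi>)"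
proof -
  let ?W = "Wasserstein_space p :: 'a measure set"
  have p: "p > 0" using \<open>p \<ge> 4\<close> by simp
  have W: "\<Phi> \<mu> \<in> ?W" if "\<mu> \<in> ?W" for \<mu> using assms(3) that by (auto simp: bij_betw_def)
  have onto: "\<exists>\<mu>\<in>?W. \<nu> = \<Phi> \<mu>" if "\<nu> \<in> ?W" for \<nu> using assms(3) that by (auto simp: bij_betw_def)
  have cost: "transport_cost p (\<Phi> \<mu>) (\<Phi> \<nu>) = transport_cost p \<mu> \<nu>" if "\<mu> \<in> ?W" "\<nu> \<in> ?W" for \<mu> \<nu>
    using assms(4) that W p by (intro transport_cost_eq_if_wasserstein_dist_eq) auto
  \<comment> \<open>The property is phrased through costs only; surjectivity of
    \<open>\<Phi>\<close> transports its quantifiers in both directions.\<close>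
  have ext: "extendable_from p (\<Phi> \<mu>) \<longleftrightarrow> extendable_from p \<mu>" if \<mu>: "\<mu> \<in> ?W" for \<mu>
  proof
    assume L: "extendable_from p (\<Phi> \<mu>)"
    show "extendable_from p \<mu>"
      unfolding extendable_from_def
    proof
      fix a assume a: "a \<in> ?W"
      with L W obtain b' where "b' \<in> ?W" "transport_cost p (\<Phi> a) b' \<le> transport_cost p (\<Phi> \<mu>) (\<Phi> a)"
        "2 ^ p * transport_cost p (\<Phi> \<mu>) (\<Phi> a) \<le> transport_cost p (\<Phi> \<mu>) b'"
        unfolding extendable_from_def by blast
      moreover obtain b where "b \<in> ?W" "b' = \<Phi> b" using onto[OF \<open>b' \<in> ?W\<close>] by blast
      ultimately show "\<exists>b\<in>?W. transport_cost p a b \<le> transport_cost p \<mu> a \<and>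
          2 ^ p * transport_cost p \<mu> a \<le> transport_cost p \<mu> b"
        using a \<mu> by (auto simp: cost)
    qed
  next
    assume R: "extendable_from p \<mu>"
    show "extendable_from p (\<Phi> \<mu>)"
      unfolding extendable_from_def
    proof
      fix a' assume "a' \<in> ?W"
      then obtain a where a: "a \<in> ?W" "a' = \<Phi> a" using onto by blast
      with R obtain b where "b \<in> ?W" "transport_cost p a b \<le> transport_cost p \<mu> a"
        "2 ^ p * transport_cost p \<mu> a \<le> transport_cost p \<mu> b"
        unfolding extendable_from_def by blast
      then show "\<exists>b\<in>?W. transport_cost p a' b \<le> transport_cost p (\<Phi> \<mu>) a' \<and>
          2 ^ p * transport_cost p (\<Phi> \<mu>) a' \<le> transport_cost p (\<Phi> \<mu>) b"
        using a \<mu> W by (intro bexI[of _ "\<Phi> b"]) (auto simp: cost)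
    qed
  qed
  have "\<exists>y. \<Phi> (return borel x) = return borel y" for x
    using extendable_from_imp_return[OF \<open>even p\<close> p W[OF return_in_wasserstein_space]]
      ext[OF return_in_wasserstein_space] extendable_from_return by metis
  then obtain \<psi> where \<psi>: "\<And>x. \<Phi> (return borel x) = return borel (\<psi> x)" by metis
  have iso: "dist (\<psi> x) (\<psi> y) = dist x y" for x y
  proof -
    have "ennreal (dist (\<psi> y) (\<psi> x) ^ p) = ennreal (dist y x ^ p)"
      using cost[OF return_in_wasserstein_space[of x] return_in_wasserstein_space[of y]]
      by (simp add: \<psi> transport_cost_return_left return_in_wasserstein_space nn_integral_return dist_norm)
    then have "dist (\<psi> y) (\<psi> x) ^ p = dist y x ^ p" by (subst (asm) ennreal_inj) auto
    then have "dist (\<psi> y) (\<psi> x) = dist y x" using p by (simp add: power_eq_iff_eq_base)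
    then show ?thesis by (simp add: dist_commute)
  qed
  \<comment> \<open>By \<open>ext\<close>, the preimage of a Dirac measure under
    \<open>\<Phi>\<close> is again a Dirac measure.\<close>
  have "surj \<psi>"
    unfolding surj_def
  proof
    fix y
    obtain \<mu> where \<mu>: "\<mu> \<in> ?W" "return borel y = \<Phi> \<mu>" using onto[OF return_in_wasserstein_space] by blast
    then have "extendable_from p \<mu>" using ext[OF \<mu>(1)] extendable_from_return[of p y] by simp
    then obtain x where "\<mu> = return borel x" using extendable_from_imp_return[OF \<open>even p\<close> p \<mu>(1)] by blast
    then have "return borel (\<psi> x) = return borel y" using \<mu> \<psi> by simp
    then have "emeasure (return borel (\<psi> x)) {y} = emeasure (return borel y) {y}" by simp
    then have "\<psi> x = y" by (auto simp: indicator_def split: if_splits)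
    then show "\<exists>x. y = \<psi> x" by blast
  qed
  moreover have "inj \<psi>" using iso by (metis dist_eq_0_iff injI)
  ultimately have bij: "bij \<psi>" by (simp add: bij_def)
  define g where "g = inv \<psi>"
  have g\<psi>: "g (\<psi> x) = x" "\<psi> (g x) = x" for x
    using bij by (simp_all add: g_def bij_is_inj bij_is_surj surj_f_inv_f)
  have isog: "dist (g x) (g y) = dist x y" for x y using iso[of "g x" "g y"] by (simp add: g\<psi>)
  have "continuous_on UNIV \<psi>" "continuous_on UNIV g" using iso isog by (auto simp: continuous_on_iff)
  then have [measurable]: "\<psi> \<in> borel_measurable borel" "g \<in> borel_measurable borel"
    by (auto intro: borel_measurable_continuous_onI)
  have g\<psi>_distr: "distr (distr \<mu> borel g) borel \<psi> = \<mu>" if "\<mu> \<in> ?W" for \<mu>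
    using distr_id2[of borel \<mu>] wasserstein_spaceD(1)[OF that]
    by (simp add: distr_distr measurable_wasserstein_space[OF that] comp_def g\<psi>)
  define \<Psi> where "\<Psi> \<mu> = distr (\<Phi> \<mu>) borel g" for \<mu>
  have fixed: "\<Psi> \<mu> = \<mu>" if "\<mu> \<in> ?W" for \<mu>
  proof (rule isometry_fixing_Diracs_eq_id[OF assms(1,2) _ _ _ that])
    show "\<Psi> \<mu> \<in> ?W" if "\<mu> \<in> ?W" for \<mu>
      unfolding \<Psi>_def
    proof (rule distr_in_wasserstein_space[OF W[OF that]])
      show "norm (g x) \<le> 1 * norm x + norm (g 0)" for x
        using isog[of x 0] norm_triangle_ineq2[of "g x" "g 0"] by (simp add: dist_norm)
    qed simp
    show "\<Psi> (return borel x) = return borel x" for x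
      by (simp add: \<Psi>_def \<psi> distr_return g\<psi>)
    show "transport_cost p (\<Psi> \<mu>) (\<Psi> \<nu>) = transport_cost p \<mu> \<nu>" if "\<mu> \<in> ?W" "\<nu> \<in> ?W" for \<mu> \<nu>
    proof (rule antisym)
      show "transport_cost p (\<Psi> \<mu>) (\<Psi> \<nu>) \<le> transport_cost p \<mu> \<nu>"
        using transport_cost_distr_isometry_le[of g p "\<Phi> \<mu>" "\<Phi> \<nu>"] isog cost[OF that]
        by (simp add: \<Psi>_def)
      \<comment> \<open>Pushing forward by \<open>\<psi>\<close> turns \<open>\<Psi>\<close> back
        into \<open>\<Phi>\<close>, so the same one-sided bound gives the reverse
        inequality.\<close>
      show "transport_cost p \<mu> \<nu> \<le> transport_cost p (\<Psi> \<mu>) (\<Psi> \<nu>)"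
        using transport_cost_distr_isometry_le[of \<psi> p "\<Psi> \<mu>" "\<Psi> \<nu>"] iso cost[OF that] W that
        by (simp add: \<Psi>_def g\<psi>_distr)
    qed
  qed
  have "\<Phi> \<mu> = distr \<mu> borel \<psi>" if "\<mu> \<in> ?W" for \<mu>
    using fixed[OF that] g\<psi>_distr[OF W[OF that]] by (simp add: \<Psi>_def)
  with bij iso show ?thesis by blast
qed

end
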